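(* Let $(E,\langle\cdot,\cdot\rangle,\Theta)$ be a Courant algebroid over a manifold $M$. If $\mathcal N$ is a Nijenhuis tensor on $E$, then for all sections $u,v$ of $E$, $$\mathcal N^2[u,v]=[u,\mathcal N^2v]\quad\text{and}\quad \mathcal N^2\,\partial\langle u,v\rangle=\partial\langle u,\mathcal N^2v\rangle.$$ If $E$ is irreducible, then any Nijenhuis tensor on $E$ is proportional to a generalized cps structure.
   Context: Vector bundles are smooth, real, of finite rank over a manifold $M$; $\Gamma E$ denotes sections. Let $(E,\langle\cdot,\cdot\rangle)$ be a vector bundle with a fiberwise non-degenerate symmetric bilinear form. Its minimal symplectic realization is the graded manifold $\widetilde E=j^!(T^*[2]E[1])$, where $j:E[1]\to E[1]\oplus E^*[1]$, $u\mapsto(u,\frac12\langle u,\cdot\rangle)$, and $j^!$ denotes pull-back by $j$. $\mathcal A=\bigoplus_k\mathcal A^k$ is the graded algebra of functions on $\widetilde E$ with its canonical Poisson bracket $\{\cdot,\cdot\}$ of degree $-2$; $\mathcal A^0=C^\infty(M)$, $\mathcal A^1=\Gamma E$, and $\{u,v\}=\langle u,v\rangle$ for sections $u,v$. (In local coordinates $(q^i,\tau^a,p_i)$ of degrees $0,1,2$ attached to a local basis $(e_a)$ with $g_{ab}=\langle e_a,e_b\rangle$ constant, the non-vanishing brackets are $\{q^i,p_j\}=\delta^i_j$, $\{\tau^a,\tau^b\}=g^{ab}$.) A Courant algebroid structure on $(E,\langle\cdot,\cdot\rangle)$ is an element $\Theta\in\mathcal A^3$ with $\{\Theta,\Theta\}=0$;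 its anchor is $\rho(u)f=\{\{u,\Theta\},f\}$, its (Dorfman) bracket is $[u,v]=\{\{u,\Theta\},v\}$, and $\partial:C^\infty(M)\to\Gamma E$ is defined by $\langle u,\partial f\rangle=\rho(u)\cdot f$. These satisfy $[u,v]+[v,u]=\partial\langle u,v\rangle$ and $\langle[u,v],w\rangle+\langle v,[u,w]\rangle=\langle u,\partial\langle v,w\rangle\rangle$. An endomorphism $\mathcal N$ of $E$ is skew-symmetric if $\langle\mathcal Nu,v\rangle+\langle u,\mathcal Nv\rangle=0$ for all $u,v$. Its torsion is $(T_\Theta\mathcal N)(u,v)=[\mathcal Nu,\mathcal Nv]-\mathcal N([\mathcal Nu,v]+[u,\mathcal Nv]-\mathcal N[u,v])$. A Nijenhuis tensor on $E$ is a skew-symmetric endomorphism with vanishing torsion. A generalized almost cps structure is a skew-symmetric endomorphism with square $-\mathrm{Id}_E$, $\mathrm{Id}_E$ or $0$; it is a generalized cps structure if moreover its torsion vanishes. "Proportional to" means equal to a real constant multiple of. The Courant algebroid $E$ is irreducible if every symmetric vector bundle endomorphism $\phi$ of $E$ (i.e. $\langle\phi u,v\rangle=\langle u,\phi v\rangle$) such that $[u,\phi v]=\phi[u,v]$ and $[\phi u,v]=\phi[u,v]$ for all sections $u,v$ is proportional to $\mathrm{Id}_E$. *)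

theory Defs
  imports "HOL-Analysis.Analysis" "HOL-Library.Multiset"
begin

section \<open>Smooth functions and manifolds\<close>

text \<open>Meant for open \<open>S\<close> and a finite-dimensional domain.\<close>

primrec Ck_on :: "nat \<Rightarrow> 'a::real_normed_vector set \<Rightarrow> ('a \<Rightarrow> 'c::real_normed_vector) \<Rightarrow> bool" where
  "Ck_on 0 S f \<longleftrightarrow> continuous_on S f"
| "Ck_on (Suc k) S f \<longleftrightarrow>
     (\<forall>x\<in>S. f differentiable (at x)) \<and>
     (\<forall>v. Ck_on k S (\<lambda>x. frechet_derivative f (at x) v))"

definition smooth_on :: "'a::real_normed_vector set \<Rightarrow> ('a \<Rightarrow> 'c::real_normed_vector) \<Rightarrow> bool" where
  "smooth_on S f \<longleftrightarrow> (\<forall>k. Ck_on k S f)"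

text \<open>
  The manifold is the whole type \<open>'m\<close>. Charts take values in \<open>'b\<close>, an inner product space with
  orthonormal basis \<open>cvec 0, \<dots>, cvec (mdim - 1)\<close>, i.e. in Euclidean space of dimension
  \<open>mdim\<close>. The class \<open>euclidean_space\<close> is not used because it excludes dimension 0
  (Courant algebroids over a point).

  The fibre of the vector bundle over \<open>x\<close> is a linear subspace \<open>fib x\<close> of a real vector space
  \<open>'v\<close>, of which no topology is used: the smooth structure is carried by the family
  \<open>bframes\<close> of local frames \<open>(U, r, e)\<close>, with \<open>e 0 x, \<dots>, e (r - 1) x\<close> a basis of \<open>fib x\<close>
  for \<open>x \<in> U\<close>. The rank may vary from one component to another.
\<close>

record ('m, 'b) mfd =
  mdim :: nat
  cvec :: "nat \<Rightarrow> 'b"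
  charts :: "('m set \<times> ('m \<Rightarrow> 'b)) set"

record ('m, 'b, 'v) vbundle = "('m, 'b) mfd" +
  fib :: "'m \<Rightarrow> 'v set"
  bframes :: "('m set \<times> nat \<times> (nat \<Rightarrow> 'm \<Rightarrow> 'v)) set"
  form :: "'m \<Rightarrow> 'v \<Rightarrow> 'v \<Rightarrow> real"

definition is_manifold ::
  "('m::{t2_space,second_countable_topology}, 'b::real_inner, 'z) mfd_scheme \<Rightarrow> bool" where
  "is_manifold M \<longleftrightarrow>
     (\<forall>i<mdim M. \<forall>j<mdim M. cvec M i \<bullet> cvec M j = (if i = j then 1 else 0)) \<and>
     span (cvec M ` {..<mdim M}) = UNIV \<and>
     (\<Union>(U, \<kappa>)\<in>charts M. U) = UNIV \<and>
     (\<forall>(U, \<kappa>)\<in>charts M. open U \<and> open (\<kappa> ` U) \<and>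
        homeomorphism U (\<kappa> ` U) \<kappa> (the_inv_into U \<kappa>)) \<and>
     (\<forall>(U, \<kappa>)\<in>charts M. \<forall>(V, \<mu>)\<in>charts M.
        smooth_on (\<kappa> ` (U \<inter> V)) (\<mu> \<circ> the_inv_into U \<kappa>))"

definition smooth_fn ::
  "('m, 'b::real_inner, 'z) mfd_scheme \<Rightarrow> 'm set \<Rightarrow> ('m \<Rightarrow> real) \<Rightarrow> bool" where
  "smooth_fn M W f \<longleftrightarrow>
     (\<forall>(U, \<kappa>)\<in>charts M. smooth_on (\<kappa> ` (U \<inter> W)) (f \<circ> the_inv_into U \<kappa>))"

section \<open>Pseudo-Euclidean vector bundles\<close>

definition frame_coeff :: "nat \<Rightarrow> (nat \<Rightarrow> 'm \<Rightarrow> 'v::real_vector) \<Rightarrow> 'm \<Rightarrow> 'v \<Rightarrow> nat \<Rightarrow> real" where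
  "frame_coeff r e x v a = representation ((\<lambda>b. e b x) ` {..<r}) v (e a x)"

definition pointwise_frame ::
  "('m, 'b, 'v::real_vector, 'z) vbundle_scheme \<Rightarrow> 'm set \<Rightarrow> nat \<Rightarrow> (nat \<Rightarrow> 'm \<Rightarrow> 'v) \<Rightarrow> bool" where
  "pointwise_frame E U r e \<longleftrightarrow>
     (\<forall>x\<in>U. inj_on (\<lambda>a. e a x) {..<r} \<and> independent ((\<lambda>a. e a x) ` {..<r}) \<and>
            span ((\<lambda>a. e a x) ` {..<r}) = fib E x)"

definition smooth_section_on ::
  "('m, 'b::real_inner, 'v::real_vector, 'z) vbundle_scheme \<Rightarrow> 'm set \<Rightarrow> ('m \<Rightarrow> 'v) \<Rightarrow> bool" where
  "smooth_section_on E W u \<longleftrightarrow>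
     (\<forall>x\<in>W. u x \<in> fib E x) \<and>
     (\<forall>(U, r, e)\<in>bframes E. \<forall>a<r. smooth_fn E (U \<inter> W) (\<lambda>x. frame_coeff r e x (u x) a))"

definition sections ::
  "('m, 'b::real_inner, 'v::real_vector, 'z) vbundle_scheme \<Rightarrow> ('m \<Rightarrow> 'v) set" where
  "sections E = {u. smooth_section_on E UNIV u}"

definition smooth_frame ::
  "('m::topological_space, 'b::real_inner, 'v::real_vector, 'z) vbundle_scheme
     \<Rightarrow> 'm set \<Rightarrow> nat \<Rightarrow> (nat \<Rightarrow> 'm \<Rightarrow> 'v) \<Rightarrow> bool" where
  "smooth_frame E U r e \<longleftrightarrow>
     open U \<and> pointwise_frame E U r e \<and> (\<forall>a<r. smooth_section_on E U (e a))"

definition is_vector_bundle ::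
  "('m::{t2_space,second_countable_topology}, 'b::real_inner, 'v::real_vector, 'z) vbundle_scheme
     \<Rightarrow> bool" where
  "is_vector_bundle E \<longleftrightarrow>
     is_manifold E \<and>
     (\<forall>x. subspace (fib E x)) \<and>
     (\<Union>(U, r, e)\<in>bframes E. U) = UNIV \<and>
     (\<forall>(U, r, e)\<in>bframes E. smooth_frame E U r e)"

definition is_pseudo_euclidean_bundle ::
  "('m::{t2_space,second_countable_topology}, 'b::real_inner, 'v::real_vector, 'z) vbundle_scheme
     \<Rightarrow> bool" where
  "is_pseudo_euclidean_bundle E \<longleftrightarrow>
     is_vector_bundle E \<and>
     (\<forall>x. \<forall>u\<in>fib E x. \<forall>v\<in>fib E x. form E x u v = form E x v u) \<and>
     (\<forall>x. \<forall>u\<in>fib E x. \<forall>v\<in>fib E x. \<forall>w\<in>fib E x.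
        form E x (u + v) w = form E x u w + form E x v w) \<and>
     (\<forall>x. \<forall>u\<in>fib E x. \<forall>v\<in>fib E x. \<forall>c. form E x (c *\<^sub>R u) v = c * form E x u v) \<and>
     (\<forall>x. \<forall>u\<in>fib E x. (\<forall>v\<in>fib E x. form E x u v = 0) \<longrightarrow> u = 0) \<and>
     (\<forall>(U, r, e)\<in>bframes E. \<forall>a<r. \<forall>b<r. smooth_fn E U (\<lambda>x. form E x (e a x) (e b x)))"

definition is_endo ::
  "('m, 'b::real_inner, 'v::real_vector, 'z) vbundle_scheme \<Rightarrow> ('m \<Rightarrow> 'v \<Rightarrow> 'v) \<Rightarrow> bool" where
  "is_endo E N \<longleftrightarrow>
     (\<forall>x. \<forall>u\<in>fib E x. N x u \<in> fib E x) \<and>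
     (\<forall>x. \<forall>u\<in>fib E x. \<forall>v\<in>fib E x. N x (u + v) = N x u + N x v) \<and>
     (\<forall>x. \<forall>u\<in>fib E x. \<forall>c. N x (c *\<^sub>R u) = c *\<^sub>R N x u) \<and>
     (\<forall>(U, r, e)\<in>bframes E. \<forall>a<r. smooth_section_on E U (\<lambda>x. N x (e a x)))"

definition endo_app :: "('m \<Rightarrow> 'v \<Rightarrow> 'v) \<Rightarrow> ('m \<Rightarrow> 'v) \<Rightarrow> 'm \<Rightarrow> 'v" where
  "endo_app N u = (\<lambda>x. N x (u x))"

definition skew_endo ::
  "('m, 'b::real_inner, 'v::real_vector, 'z) vbundle_scheme \<Rightarrow> ('m \<Rightarrow> 'v \<Rightarrow> 'v) \<Rightarrow> bool" where
  "skew_endo E N \<longleftrightarrow> is_endo E N \<and>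
     (\<forall>x. \<forall>u\<in>fib E x. \<forall>v\<in>fib E x. form E x (N x u) v + form E x u (N x v) = 0)"

definition symmetric_endo ::
  "('m, 'b::real_inner, 'v::real_vector, 'z) vbundle_scheme \<Rightarrow> ('m \<Rightarrow> 'v \<Rightarrow> 'v) \<Rightarrow> bool" where
  "symmetric_endo E N \<longleftrightarrow> is_endo E N \<and>
     (\<forall>x. \<forall>u\<in>fib E x. \<forall>v\<in>fib E x. form E x (N x u) v = form E x u (N x v))"

definition proportional ::
  "('m, 'b, 'v::real_vector, 'z) vbundle_scheme \<Rightarrow> ('m \<Rightarrow> 'v \<Rightarrow> 'v) \<Rightarrow> ('m \<Rightarrow> 'v \<Rightarrow> 'v) \<Rightarrow> bool"
  where
  "proportional E N J \<longleftrightarrow> (\<exists>c. \<forall>x. \<forall>u\<in>fib E x. N x u = c *\<^sub>R J x u)"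

section \<open>The minimal symplectic realization in local coordinates\<close>

text \<open>
  \<open>f I J\<close> is the coefficient of \<open>\<tau>\<^sup>I p\<^sup>J\<close>, where \<open>\<tau>\<^sup>I\<close> is the product of the odd generators
  \<open>\<tau>\<^sup>a\<close>, \<open>a \<in> I\<close>, in increasing order, and the even generator \<open>p\<^sub>i\<close> occurs \<open>count J i\<close> times.
\<close>

type_synonym gpoly = "nat set \<Rightarrow> nat multiset \<Rightarrow> real"

text \<open>\<open>\<tau>\<^sup>I \<tau>\<^sup>K = ksign I K \<tau>\<^sup>I\<^sup>\<union>\<^sup>K\<close> for disjoint \<open>I\<close> and \<open>K\<close>.\<close>

definition ksign :: "nat set \<Rightarrow> nat set \<Rightarrow> real" where
  "ksign I K = (-1) ^ card {(a, b). a \<in> I \<and> b \<in> K \<and> b < a}"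

definition gone :: gpoly where
  "gone = (\<lambda>I J. if I = {} \<and> J = {#} then 1 else 0)"

definition gmult :: "gpoly \<Rightarrow> gpoly \<Rightarrow> gpoly" where
  "gmult f g = (\<lambda>I J. \<Sum>I'\<in>Pow I. \<Sum>J'\<in>{J'. J' \<subseteq># J}.
     ksign I' (I - I') * f I' J' * g (I - I') (J - J'))"

definition gprod :: "gpoly list \<Rightarrow> gpoly" where
  "gprod fs = foldr gmult fs gone"

definition gtau :: "nat \<Rightarrow> gpoly" where
  "gtau a = (\<lambda>I J. if I = {a} \<and> J = {#} then 1 else 0)"

definition gmom :: "nat \<Rightarrow> gpoly" where
  "gmom i = (\<lambda>I J. if I = {} \<and> J = {#i#} then 1 else 0)"

definition dtau_left :: "nat \<Rightarrow> gpoly \<Rightarrow> gpoly" where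
  "dtau_left a f = (\<lambda>I J. if a \<in> I then 0 else ksign {a} I * f (insert a I) J)"

definition dtau_right :: "nat \<Rightarrow> gpoly \<Rightarrow> gpoly" where
  "dtau_right a f = (\<lambda>I J. if a \<in> I then 0 else ksign I {a} * f (insert a I) J)"

definition dmom :: "nat \<Rightarrow> gpoly \<Rightarrow> gpoly" where
  "dmom i f = (\<lambda>I J. real (count J i + 1) * f I (add_mset i J))"

text \<open>
  Local coordinates \<open>(q\<^sup>i, \<tau>\<^sup>a, p\<^sub>i)\<close> are attached to a chart and a local frame \<open>(e\<^sub>a)\<close> with constant
  \<open>g\<^sub>a\<^sub>b = \<langle>e\<^sub>a, e\<^sub>b\<rangle>\<close> on their common domain.
\<close>

record ('m, 'b, 'v) coord =
  cdom :: "'m set"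
  cchart :: "'m \<Rightarrow> 'b"
  crank :: nat
  cframe :: "nat \<Rightarrow> 'm \<Rightarrow> 'v"

definition gram ::
  "('m, 'b, 'v, 'z) vbundle_scheme \<Rightarrow> ('m, 'b, 'v) coord \<Rightarrow> 'm \<Rightarrow> nat \<Rightarrow> nat \<Rightarrow> real" where
  "gram E c x a b = form E x (cframe c a x) (cframe c b x)"

definition coords ::
  "('m::topological_space, 'b::real_inner, 'v::real_vector, 'z) vbundle_scheme
     \<Rightarrow> ('m, 'b, 'v) coord set" where
  "coords E = {c.
     (\<exists>V. (V, cchart c) \<in> charts E \<and> cdom c \<subseteq> V) \<and>
     smooth_frame E (cdom c) (crank c) (cframe c) \<and>
     (\<forall>x\<in>cdom c. \<forall>y\<in>cdom c. \<forall>a<crank c. \<forall>b<crank c. gram E c x a b = gram E c y a b)}"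

definition gram_inv ::
  "('m, 'b, 'v, 'z) vbundle_scheme \<Rightarrow> ('m, 'b, 'v) coord \<Rightarrow> 'm \<Rightarrow> nat \<Rightarrow> nat \<Rightarrow> real" where
  "gram_inv E c x = (THE h.
     (\<forall>a b. \<not> (a < crank c \<and> b < crank c) \<longrightarrow> h a b = 0) \<and>
     (\<forall>a<crank c. \<forall>b<crank c.
        (\<Sum>d<crank c. h a d * gram E c x d b) = (if a = b then 1 else 0)))"

text \<open>The partial derivative \<open>\<partial>f/\<partial>q\<^sup>i\<close> at \<open>x\<close> in the chart of \<open>c\<close>.\<close>

definition cderiv ::
  "('m, 'b::real_inner, 'v, 'z) vbundle_scheme \<Rightarrow> ('m, 'b, 'v) coord
     \<Rightarrow> nat \<Rightarrow> ('m \<Rightarrow> real) \<Rightarrow> 'm \<Rightarrow> real" where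
  "cderiv E c i f x =
     frechet_derivative (f \<circ> the_inv_into (cdom c) (cchart c)) (at (cchart c x)) (cvec E i)"

text \<open>
  The change of coordinates from \<open>c\<close> (unprimed) to \<open>c'\<close> (primed) is the pull-back along \<open>j\<close> of the
  cotangent lift of \<open>q = q(q')\<close>, \<open>\<tau>\<^sup>a = S\<^sup>a\<^sub>b(q') \<tau>'\<^sup>b\<close>, where \<open>e'\<^sub>b = S\<^sup>a\<^sub>b e\<^sub>a\<close>. Writing \<open>\<theta>\<^sub>a\<close> for the
  momentum of \<open>\<tau>\<^sup>a\<close>, the cotangent lift is
  \<open>p'\<^sub>k = (\<partial>q\<^sup>i/\<partial>q'\<^sup>k) p\<^sub>i + \<theta>\<^sub>a (\<partial>S\<^sup>a\<^sub>b/\<partial>q'\<^sup>k) \<tau>'\<^sup>b\<close>, and \<open>j\<close> imposes \<open>\<theta>\<^sub>a = g\<^sub>a\<^sub>d \<tau>\<^sup>d / 2\<close>.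
  \<open>transition E c c' x\<close> is the resulting algebra morphism from polynomials in \<open>(\<tau>', p')\<close> to
  polynomials in \<open>(\<tau>, p)\<close> over the point \<open>x\<close>.
\<close>

definition tau_image ::
  "('m, 'b::real_inner, 'v::real_vector) coord \<Rightarrow> ('m, 'b, 'v) coord \<Rightarrow> 'm \<Rightarrow> nat \<Rightarrow> gpoly" where
  "tau_image c c' x b = (\<lambda>I J. \<Sum>d<crank c.
     frame_coeff (crank c') (cframe c') x (cframe c d x) b * gtau d I J)"

definition mom_image ::
  "('m, 'b::real_inner, 'v::real_vector, 'z) vbundle_scheme
     \<Rightarrow> ('m, 'b, 'v) coord \<Rightarrow> ('m, 'b, 'v) coord \<Rightarrow> 'm \<Rightarrow> nat \<Rightarrow> gpoly" where
  "mom_image E c c' x k = (\<lambda>I J.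
     (\<Sum>i<mdim E. cderiv E c' k (\<lambda>y. cchart c y \<bullet> cvec E i) x * gmom i I J) +
     (\<Sum>a<crank c. \<Sum>d<crank c. \<Sum>b<crank c'.
        1/2 * gram E c x a d *
        cderiv E c' k (\<lambda>y. frame_coeff (crank c) (cframe c) y (cframe c' b y) a) x *
        gmult (gtau d) (tau_image c c' x b) I J))"

definition transition ::
  "('m, 'b::real_inner, 'v::real_vector, 'z) vbundle_scheme
     \<Rightarrow> ('m, 'b, 'v) coord \<Rightarrow> ('m, 'b, 'v) coord \<Rightarrow> 'm \<Rightarrow> gpoly \<Rightarrow> gpoly" where
  "transition E c c' x f = (\<lambda>I J. \<Sum>(I', J')\<in>{(I', J'). f I' J' \<noteq> 0}.
     f I' J' * gmult (gprod (map (tau_image c c' x) (sorted_list_of_set I')))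
                     (gprod (map (mom_image E c c' x) (sorted_list_of_multiset J'))) I J)"

text \<open>
  A function on the graded manifold is a family of local expressions, one for each local coordinate
  system, which agree on overlaps. \<open>graded_fn E k\<close> is the component of degree \<open>k\<close>; the values of
  the family outside the coordinate domains are irrelevant.
\<close>

type_synonym ('m, 'b, 'v) gfn = "('m, 'b, 'v) coord \<Rightarrow> 'm \<Rightarrow> gpoly"

definition graded_fn ::
  "('m::topological_space, 'b::real_inner, 'v::real_vector, 'z) vbundle_scheme
     \<Rightarrow> nat \<Rightarrow> ('m, 'b, 'v) gfn set" where
  "graded_fn E k = {F.
     (\<forall>c\<in>coords E. \<forall>I J. smooth_fn E (cdom c) (\<lambda>x. F c x I J)) \<and>
     (\<forall>c\<in>coords E. \<forall>x\<in>cdom c. \<forall>I J. F c x I J \<noteq> 0 \<longrightarrow>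
        I \<subseteq> {..<crank c} \<and> set_mset J \<subseteq> {..<mdim E} \<and> card I + 2 * size J = k) \<and>
     (\<forall>c\<in>coords E. \<forall>c'\<in>coords E. \<forall>x\<in>cdom c \<inter> cdom c'.
        F c x = transition E c c' x (F c' x))}"

definition gfn_zero ::
  "('m::topological_space, 'b::real_inner, 'v::real_vector, 'z) vbundle_scheme
     \<Rightarrow> ('m, 'b, 'v) gfn \<Rightarrow> bool" where
  "gfn_zero E F \<longleftrightarrow> (\<forall>c\<in>coords E. \<forall>x\<in>cdom c. \<forall>I J. F c x I J = 0)"

text \<open>
  The biderivation with \<open>{q\<^sup>i, p\<^sub>j} = \<delta>\<^sup>i\<^sub>j\<close>, \<open>{\<tau>\<^sup>a, \<tau>\<^sup>b} = g\<^sup>a\<^sup>b\<close> and all other brackets of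
  coordinates zero.
\<close>

definition pbracket ::
  "('m, 'b::real_inner, 'v, 'z) vbundle_scheme
     \<Rightarrow> ('m, 'b, 'v) gfn \<Rightarrow> ('m, 'b, 'v) gfn \<Rightarrow> ('m, 'b, 'v) gfn" where
  "pbracket E F G = (\<lambda>c x I J.
     (\<Sum>i<mdim E.
        gmult (\<lambda>K L. cderiv E c i (\<lambda>y. F c y K L) x) (dmom i (G c x)) I J
      - gmult (dmom i (F c x)) (\<lambda>K L. cderiv E c i (\<lambda>y. G c y K L) x) I J) +
     (\<Sum>a<crank c. \<Sum>b<crank c.
        gram_inv E c x a b * gmult (dtau_right a (F c x)) (dtau_left b (G c x)) I J))"

text \<open>
  The identifications of degree 0 with functions on \<open>M\<close> and of degree 1 with sections of \<open>E\<close>. The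
  section \<open>u\<close> corresponds to \<open>\<langle>u, e\<^sub>a\<rangle> \<tau>\<^sup>a\<close>, so that \<open>{u, v} = \<langle>u, v\<rangle>\<close>. In the reverse direction, the
  value at \<open>x\<close> is read off in some coordinate system around \<open>x\<close>; for elements of \<open>graded_fn E 0\<close>,
  \<open>graded_fn E 1\<close> the result does not depend on it.
\<close>

definition of_fn :: "('m \<Rightarrow> real) \<Rightarrow> ('m, 'b, 'v) gfn" where
  "of_fn f = (\<lambda>c x I J. if I = {} \<and> J = {#} then f x else 0)"

definition of_section ::
  "('m, 'b, 'v, 'z) vbundle_scheme \<Rightarrow> ('m \<Rightarrow> 'v) \<Rightarrow> ('m, 'b, 'v) gfn" where
  "of_section E u = (\<lambda>c x I J. \<Sum>a<crank c. form E x (u x) (cframe c a x) * gtau a I J)"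

definition coord_at ::
  "('m::topological_space, 'b::real_inner, 'v::real_vector, 'z) vbundle_scheme
     \<Rightarrow> 'm \<Rightarrow> ('m, 'b, 'v) coord" where
  "coord_at E x = (SOME c. c \<in> coords E \<and> x \<in> cdom c)"

definition to_fn ::
  "('m::topological_space, 'b::real_inner, 'v::real_vector, 'z) vbundle_scheme
     \<Rightarrow> ('m, 'b, 'v) gfn \<Rightarrow> 'm \<Rightarrow> real" where
  "to_fn E F = (\<lambda>x. F (coord_at E x) x {} {#})"

definition to_section ::
  "('m::topological_space, 'b::real_inner, 'v::real_vector, 'z) vbundle_scheme
     \<Rightarrow> ('m, 'b, 'v) gfn \<Rightarrow> 'm \<Rightarrow> 'v" where
  "to_section E F = (\<lambda>x. THE w. w \<in> fib E x \<and>
     (\<forall>a<crank (coord_at E x).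
        form E x w (cframe (coord_at E x) a x) = F (coord_at E x) x {a} {#}))"

section \<open>Courant algebroids and Nijenhuis tensors\<close>

definition is_courant_structure ::
  "('m::topological_space, 'b::real_inner, 'v::real_vector, 'z) vbundle_scheme
     \<Rightarrow> ('m, 'b, 'v) gfn \<Rightarrow> bool" where
  "is_courant_structure E \<Theta> \<longleftrightarrow> \<Theta> \<in> graded_fn E 3 \<and> gfn_zero E (pbracket E \<Theta> \<Theta>)"

definition anchor ::
  "('m::topological_space, 'b::real_inner, 'v::real_vector, 'z) vbundle_scheme
     \<Rightarrow> ('m, 'b, 'v) gfn \<Rightarrow> ('m \<Rightarrow> 'v) \<Rightarrow> ('m \<Rightarrow> real) \<Rightarrow> 'm \<Rightarrow> real" where
  "anchor E \<Theta> u f = to_fn E (pbracket E (pbracket E (of_section E u) \<Theta>) (of_fn f))"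

definition dorfman ::
  "('m::topological_space, 'b::real_inner, 'v::real_vector, 'z) vbundle_scheme
     \<Rightarrow> ('m, 'b, 'v) gfn \<Rightarrow> ('m \<Rightarrow> 'v) \<Rightarrow> ('m \<Rightarrow> 'v) \<Rightarrow> 'm \<Rightarrow> 'v" where
  "dorfman E \<Theta> u v =
     to_section E (pbracket E (pbracket E (of_section E u) \<Theta>) (of_section E v))"

definition courant_d ::
  "('m::topological_space, 'b::real_inner, 'v::real_vector, 'z) vbundle_scheme
     \<Rightarrow> ('m, 'b, 'v) gfn \<Rightarrow> ('m \<Rightarrow> real) \<Rightarrow> 'm \<Rightarrow> 'v" where
  "courant_d E \<Theta> f = (\<lambda>x. THE w. w \<in> fib E x \<and>
     (\<forall>u\<in>sections E. form E x (u x) w = anchor E \<Theta> u f x))"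

definition pairing ::
  "('m, 'b, 'v, 'z) vbundle_scheme \<Rightarrow> ('m \<Rightarrow> 'v) \<Rightarrow> ('m \<Rightarrow> 'v) \<Rightarrow> 'm \<Rightarrow> real" where
  "pairing E u v = (\<lambda>x. form E x (u x) (v x))"

definition torsion ::
  "('m::topological_space, 'b::real_inner, 'v::real_vector, 'z) vbundle_scheme
     \<Rightarrow> ('m, 'b, 'v) gfn \<Rightarrow> ('m \<Rightarrow> 'v \<Rightarrow> 'v) \<Rightarrow> ('m \<Rightarrow> 'v) \<Rightarrow> ('m \<Rightarrow> 'v) \<Rightarrow> 'm \<Rightarrow> 'v" where
  "torsion E \<Theta> N u v = (\<lambda>x.
     dorfman E \<Theta> (endo_app N u) (endo_app N v) x
     - N x (dorfman E \<Theta> (endo_app N u) v x + dorfman E \<Theta> u (endo_app N v) x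
            - N x (dorfman E \<Theta> u v x)))"

definition torsion_free ::
  "('m::topological_space, 'b::real_inner, 'v::real_vector, 'z) vbundle_scheme
     \<Rightarrow> ('m, 'b, 'v) gfn \<Rightarrow> ('m \<Rightarrow> 'v \<Rightarrow> 'v) \<Rightarrow> bool" where
  "torsion_free E \<Theta> N \<longleftrightarrow>
     (\<forall>u\<in>sections E. \<forall>v\<in>sections E. \<forall>x. torsion E \<Theta> N u v x = 0)"

definition nijenhuis_tensor ::
  "('m::topological_space, 'b::real_inner, 'v::real_vector, 'z) vbundle_scheme
     \<Rightarrow> ('m, 'b, 'v) gfn \<Rightarrow> ('m \<Rightarrow> 'v \<Rightarrow> 'v) \<Rightarrow> bool" where
  "nijenhuis_tensor E \<Theta> N \<longleftrightarrow> skew_endo E N \<and> torsion_free E \<Theta> N"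

definition generalized_almost_cps ::
  "('m, 'b::real_inner, 'v::real_vector, 'z) vbundle_scheme \<Rightarrow> ('m \<Rightarrow> 'v \<Rightarrow> 'v) \<Rightarrow> bool" where
  "generalized_almost_cps E J \<longleftrightarrow> skew_endo E J \<and>
     ((\<forall>x. \<forall>u\<in>fib E x. J x (J x u) = - u) \<or>
      (\<forall>x. \<forall>u\<in>fib E x. J x (J x u) = u) \<or>
      (\<forall>x. \<forall>u\<in>fib E x. J x (J x u) = 0))"

definition generalized_cps ::
  "('m::topological_space, 'b::real_inner, 'v::real_vector, 'z) vbundle_scheme
     \<Rightarrow> ('m, 'b, 'v) gfn \<Rightarrow> ('m \<Rightarrow> 'v \<Rightarrow> 'v) \<Rightarrow> bool" where
  "generalized_cps E \<Theta> J \<longleftrightarrow> generalized_almost_cps E J \<and> torsion_free E \<Theta> J"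

definition irreducible_courant ::
  "('m::topological_space, 'b::real_inner, 'v::real_vector, 'z) vbundle_scheme
     \<Rightarrow> ('m, 'b, 'v) gfn \<Rightarrow> bool" where
  "irreducible_courant E \<Theta> \<longleftrightarrow>
     (\<forall>\<phi>. symmetric_endo E \<phi> \<and>
        (\<forall>u\<in>sections E. \<forall>v\<in>sections E.
           dorfman E \<Theta> u (endo_app \<phi> v) = endo_app \<phi> (dorfman E \<Theta> u v) \<and>
           dorfman E \<Theta> (endo_app \<phi> u) v = endo_app \<phi> (dorfman E \<Theta> u v))
        \<longrightarrow> proportional E \<phi> (\<lambda>x v. v))"

end

theory Submission
  imports Defs
begin

text \<open>
  Let \<open>T\<close> be the torsion of \<open>N\<close>. The theorem rests on two identities for the Dorfman bracket,

    \<open>[u, v] + [v, u] = \<partial>\<langle>u, v\<rangle>\<close>  and  \<open>\<langle>[u, v], w\<rangle> + \<langle>v, [u, w]\<rangle> = \<langle>u, \<partial>\<langle>v, w\<rangle>\<rangle>\<close>.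

  The first one turns \<open>T(u, v) + T(v, u)\<close> into \<open>N\<^sup>2 \<partial>\<langle>u, v\<rangle> - \<partial>\<langle>u, N\<^sup>2 v\<rangle>\<close>, because \<open>N\<close> is skew
  (\<open>nijenhuis_square_courant_d\<close>). Applied to all terms of \<open>\<langle>T(u, v), w\<rangle> + \<langle>v, T(u, w)\<rangle>\<close>, the second
  one leaves \<open>\<langle>v, N\<^sup>2 [u, w] - [u, N\<^sup>2 w]\<rangle>\<close> (\<open>nijenhuis_square_dorfman\<close>). Both sums vanish when
  \<open>T = 0\<close>, and together the two results give \<open>[N\<^sup>2 u, v] = N\<^sup>2 [u, v]\<close> as well. The endomorphism \<open>N\<^sup>2\<close>
  is symmetric, so irreducibility forces \<open>N\<^sup>2 = k Id\<close> with a real constant \<open>k\<close>. Then \<open>N\<close> itself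
  (if \<open>k = 0\<close>) or \<open>N / sqrt \<bar>k\<bar>\<close> is a generalized cps structure
  (\<open>nijenhuis_proportional_cps\<close>).

  The bracket is a derived bracket on a graded manifold, and the identities are checked at one point
  \<open>x\<close> in the coordinate system \<open>coord_at E x\<close>. For this, coordinate systems must exist: a
  Gram-Schmidt procedure with smooth dependence on the point yields local frames with constant Gram
  matrix (\<open>orthonormal_step\<close>, \<open>exists_coord\<close>). With \<open>u\<^sub>a = \<langle>u, e\<^sub>a\<rangle>\<close> and \<open>u\<^sup>b = g\<^sup>a\<^sup>b u\<^sub>a\<close>, the Poisson
  brackets give

    \<open>\<langle>[u, v], e\<^sub>a\<rangle> = \<rho>(u) v\<^sub>a - \<rho>(v) u\<^sub>a + v\<^sup>b \<rho>(e\<^sub>a) u\<^sub>b + u\<^sup>d v\<^sup>b C\<^sub>d\<^sub>a\<^sub>b\<close>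

  with \<open>C\<close> totally skew (\<open>form_dorfman\<close>), from which both identities are read off. The definition of
  \<open>\<partial>f\<close> determines it through its products with global sections, so every vector has to be the value of
  a global section; these are obtained from bump functions (\<open>exists_section\<close>).
\<close>

section \<open>Calculus of smooth functions\<close>

lemma Ck_on_Suc_imp: "Ck_on (Suc k) S f \<Longrightarrow> Ck_on k S f"
proof (induction k arbitrary: f)
  case 0
  then show ?case
    by (auto intro!: continuous_at_imp_continuous_on differentiable_imp_continuous_within)
next
  case (Suc k)
  then show ?case by (metis Ck_on.simps(2))
qed

lemma Ck_on_subset: "Ck_on k S f \<Longrightarrow> T \<subseteq> S \<Longrightarrow> Ck_on k T f"
  by (induction k arbitrary: f) (auto intro: continuous_on_subset)

lemma Ck_on_local:
  assumes "\<And>x. x \<in> S \<Longrightarrow> \<exists>T. open T \<and> x \<in> T \<and> Ck_on k T f"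
  shows "Ck_on k S f"
  using assms
proof (induction k arbitrary: f)
  case 0
  have "isCont f x" if x: "x \<in> S" for x
  proof -
    from 0(1)[OF x] obtain T where "open T" "x \<in> T" "continuous_on T f" by auto
    then show ?thesis by (simp add: continuous_on_eq_continuous_at)
  qed
  then show ?case by (simp add: continuous_at_imp_continuous_on)
next
  case (Suc k)
  have "f differentiable at x" if x: "x \<in> S" for x
    using Suc.prems[OF x] by auto
  moreover have "Ck_on k S (\<lambda>x. frechet_derivative f (at x) v)" for v
  proof (rule Suc.IH)
    fix x assume "x \<in> S"
    from Suc.prems[OF this] obtain T where "open T" "x \<in> T" "Ck_on (Suc k) T f" by blast
    then show "\<exists>T. open T \<and> x \<in> T \<and> Ck_on k T (\<lambda>x. frechet_derivative f (at x) v)"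
      by auto
  qed
  ultimately show ?case by simp
qed

lemma Ck_on_cong:
  assumes "open S" "\<And>x. x \<in> S \<Longrightarrow> f x = g x"
  shows "Ck_on k S f \<longleftrightarrow> Ck_on k S g"
proof -
  have "Ck_on k S f \<Longrightarrow> Ck_on k S g" if "\<And>x. x \<in> S \<Longrightarrow> f x = g x" for f g :: "'a \<Rightarrow> 'b"
    using that
  proof (induction k arbitrary: f g)
    case 0
    then show ?case using continuous_on_cong[of S S f g] by simp
  next
    case (Suc k)
    have d: "(g has_derivative frechet_derivative f (at x)) (at x)" if "x \<in> S" for x
      using Suc.prems that \<open>open S\<close>
      by (metis Ck_on.simps(2) frechet_derivative_works has_derivative_transform_within_open)
    have "frechet_derivative f (at x) = frechet_derivative g (at x)" if "x \<in> S" for x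
      using d[OF that] by (rule frechet_derivative_at)
    moreover have "g differentiable at x" if "x \<in> S" for x
      using d[OF that] by (rule differentiableI)
    ultimately show ?case
      using Suc.IH[of "\<lambda>x. frechet_derivative f (at x) v" "\<lambda>x. frechet_derivative g (at x) v" for v] Suc.prems(1)
      by auto
  qed
  then show ?thesis using assms(2) by metis
qed

text \<open>Any expression \<open>D\<close> for the derivative on the open set may replace \<open>frechet_derivative\<close>.\<close>

lemma Ck_on_SucI:
  assumes "open S" "\<And>x. x \<in> S \<Longrightarrow> (f has_derivative D x) (at x)"
    and "\<And>v. Ck_on k S (\<lambda>x. D x v)"
  shows "Ck_on (Suc k) S f"
proof -
  have "frechet_derivative f (at x) = D x" if "x \<in> S" for x
    using frechet_derivative_at[OF assms(2)[OF that]] by simp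
  then have "Ck_on k S (\<lambda>x. frechet_derivative f (at x) v)" for v
    using Ck_on_cong[OF \<open>open S\<close>, of "\<lambda>x. frechet_derivative f (at x) v" "\<lambda>x. D x v"] assms(3) by auto
  then show ?thesis using assms(2) by (auto intro: differentiableI)
qed

lemma Ck_on_SucD:
  assumes "Ck_on (Suc k) S f"
  shows "x \<in> S \<Longrightarrow> (f has_derivative frechet_derivative f (at x)) (at x)"
    and "Ck_on k S (\<lambda>x. frechet_derivative f (at x) v)"
  using assms by (auto simp: frechet_derivative_works)

lemma Ck_on_const: "Ck_on k S (\<lambda>x. c)"
  by (induction k arbitrary: c) (auto simp: frechet_derivative_const)

lemma Ck_on_add:
  assumes "open S"
  shows "Ck_on k S f \<Longrightarrow> Ck_on k S g \<Longrightarrow> Ck_on k S (\<lambda>x. f x + g x)"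
proof (induction k arbitrary: f g)
  case 0
  then show ?case by (simp add: continuous_on_add)
next
  case (Suc k)
  note f = Ck_on_SucD[OF Suc.prems(1)] and g = Ck_on_SucD[OF Suc.prems(2)]
  show ?case
    by (rule Ck_on_SucI[OF assms has_derivative_add[OF f(1) g(1)] Suc.IH[OF f(2) g(2)]])
qed

lemma Ck_on_mult:
  fixes f g :: "'a::real_normed_vector \<Rightarrow> real"
  assumes "open S"
  shows "Ck_on k S f \<Longrightarrow> Ck_on k S g \<Longrightarrow> Ck_on k S (\<lambda>x. f x * g x)"
proof (induction k arbitrary: f g)
  case 0
  then show ?case by (simp add: continuous_on_mult)
next
  case (Suc k)
  note f = Ck_on_SucD[OF Suc.prems(1)] and g = Ck_on_SucD[OF Suc.prems(2)]
  show ?case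
    by (rule Ck_on_SucI[OF assms has_derivative_mult[OF f(1) g(1)]])
      (auto intro!: Ck_on_add[OF assms] Suc.IH f(2) g(2) Ck_on_Suc_imp[OF Suc.prems(1)]
        Ck_on_Suc_imp[OF Suc.prems(2)])
qed

lemma Ck_on_inner_left:
  fixes f :: "'a::real_normed_vector \<Rightarrow> 'b::real_inner"
  assumes "open S"
  shows "Ck_on k S f \<Longrightarrow> Ck_on k S (\<lambda>x. f x \<bullet> b)"
proof (induction k arbitrary: f)
  case 0
  then show ?case by (auto intro: continuous_intros)
next
  case (Suc k)
  note f = Ck_on_SucD[OF Suc.prems(1)]
  show ?case
    by (rule Ck_on_SucI[OF assms has_derivative_inner_left[OF f(1)] Suc.IH[OF f(2)]])
qed

text \<open>
  The chain rule, for an outer function that is given together with its successive derivatives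
  \<open>\<psi> 0, \<psi> 1, \<dots>\<close>.
\<close>

lemma Ck_on_compose:
  fixes \<psi> :: "nat \<Rightarrow> real \<Rightarrow> real"
  assumes "open S" and \<psi>: "\<And>n y. y \<in> T \<Longrightarrow> (\<psi> n has_real_derivative \<psi> (Suc n) y) (at y)"
    and f: "Ck_on k S f" "f ` S \<subseteq> T"
  shows "Ck_on k S (\<lambda>x. \<psi> n (f x))"
  using f
proof (induction k arbitrary: n)
  case 0
  have "continuous_on T (\<psi> n)"
    using \<psi> by (meson DERIV_isCont continuous_at_imp_continuous_on)
  with 0 show ?case by (auto intro: continuous_on_compose2)
next
  case (Suc k)
  note f = Ck_on_SucD[OF Suc.prems(1)]
  have d: "((\<lambda>x. \<psi> n (f x)) has_derivative (\<lambda>v. \<psi> (Suc n) (f x) * frechet_derivative f (at x) v)) (at x)"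
    if "x \<in> S" for x
    using has_derivative_compose[OF f(1)[OF that], of "\<psi> n" "(*) (\<psi> (Suc n) (f x))"] \<psi>[of "f x" n] that Suc.prems
    by (auto simp: has_field_derivative_def)
  show ?case
    by (rule Ck_on_SucI[OF assms(1) d])
     (auto intro!: Ck_on_mult[OF assms(1)] f(2) Suc.IH Ck_on_Suc_imp[OF Suc.prems(1)] Suc.prems(2))
qed

text \<open>The successive derivatives of \<open>y powr (- 1/2)\<close>, in the form that the chain rule needs.\<close>

lemma has_real_derivative_powr_minus_half:
  defines "c \<equiv> \<lambda>n::nat. (\<Prod>j<n. - 1/2 - real j)"
  assumes "y > 0"
  shows "((\<lambda>y. c n * y powr (- 1/2 - real n)) has_real_derivative
     c (Suc n) * y powr (- 1/2 - real (Suc n))) (at y)"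
proof -
  have "((\<lambda>y. c n * y powr (- 1/2 - real n)) has_real_derivative
     c n * ((- 1/2 - real n) * y powr (- 1/2 - real n - 1))) (at y)"
    by (intro DERIV_cmult has_real_derivative_powr assms)
  moreover have "- 1/2 - real n - 1 = - 1/2 - real (Suc n)" by simp
  ultimately show ?thesis by (simp add: c_def mult.assoc)
qed

lemma Ck_on_powr_minus_half:
  fixes f :: "'a::real_normed_vector \<Rightarrow> real"
  assumes "open S" "Ck_on k S f" "\<And>x. x \<in> S \<Longrightarrow> f x > 0"
  shows "Ck_on k S (\<lambda>x. f x powr (- 1/2))"
proof -
  let ?\<psi> = "\<lambda>n y. (\<Prod>j<n. - 1/2 - real j) * y powr (- 1/2 - real n)"
  have "Ck_on k S (\<lambda>x. ?\<psi> 0 (f x))"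
  proof (rule Ck_on_compose[where T = "{0<..}" and \<psi> = ?\<psi>, OF assms(1) _ assms(2)])
    show "(?\<psi> n has_real_derivative ?\<psi> (Suc n) y) (at y)" if "y \<in> {0<..}" for n y
      by (rule has_real_derivative_powr_minus_half) (use that in simp)
    show "f ` S \<subseteq> {0<..}" using assms(3) by auto
  qed
  then show ?thesis by simp
qed

section \<open>A smooth function that vanishes exactly on a half line\<close>

text \<open>
  The functions \<open>p (1/t) exp (-1/t)\<close> for \<open>t > 0\<close>, extended by zero, with \<open>p\<close> a polynomial. This
  family is closed under differentiation.
\<close>

definition flat_fn :: "real poly \<Rightarrow> real \<Rightarrow> real" where
  "flat_fn p t = (if t > 0 then poly p (1 / t) * exp (- (1 / t)) else 0)"

text \<open>The polynomial that belongs to the derivative of \<open>flat_fn p\<close>.\<close>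

definition flat_deriv :: "real poly \<Rightarrow> real poly" where
  "flat_deriv p = [:0, 0, 1:] * (p - pderiv p)"

lemma poly_times_exp_minus_tendsto_0:
  "((\<lambda>x. poly p x * exp (- x)) \<longlongrightarrow> 0) (at_top :: real filter)"
proof -
  have "((\<lambda>x. \<Sum>i\<le>degree p. coeff p i * (x ^ i / exp x)) \<longlongrightarrow> 0) (at_top :: real filter)"
    by (intro tendsto_null_sum tendsto_mult_right_zero tendsto_power_div_exp_0)
  then show ?thesis
    by (simp add: poly_altdef exp_minus sum_distrib_right divide_inverse mult.assoc)
qed

lemma flat_fn_has_derivative:
  "(flat_fn p has_real_derivative flat_fn (flat_deriv p) t) (at t)"
proof -
  consider "t > 0" | "t < 0" | "t = 0" by linarith
  then show ?thesis
  proof cases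
    case 1
    have "((\<lambda>t. poly p (1 / t) * exp (- (1 / t))) has_real_derivative
        flat_fn (flat_deriv p) t) (at t)"
      using 1 unfolding flat_fn_def flat_deriv_def
      by (auto intro!: derivative_eq_intros simp: field_simps power2_eq_square)
    moreover have "open {0::real<..}" "t \<in> {0<..}" using 1 by auto
    ultimately show ?thesis
      by (rule has_field_derivative_transform_within_open) (simp add: flat_fn_def)
  next
    case 2
    have "((\<lambda>t. 0) has_real_derivative flat_fn (flat_deriv p) t) (at t)"
      using 2 by (simp add: flat_fn_def)
    moreover have "open {..<(0::real)}" "t \<in> {..<0}" using 2 by auto
    ultimately show ?thesis
      by (rule has_field_derivative_transform_within_open) (simp add: flat_fn_def)
  next
    case 3
    have "((\<lambda>h. poly (pCons 0 p) (inverse h) * exp (- inverse h)) \<longlongrightarrow> 0) (at_right (0::real))"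
      using filterlim_compose[OF poly_times_exp_minus_tendsto_0 filterlim_inverse_at_top_right] .
    then have "((\<lambda>h. flat_fn p h / h) \<longlongrightarrow> 0) (at_right 0)"
      by (rule Lim_transform_eventually)
        (auto simp: eventually_at_filter flat_fn_def divide_inverse intro!: always_eventually)
    moreover have "((\<lambda>h. flat_fn p h / h) \<longlongrightarrow> 0) (at_left 0)"
      by (rule Lim_transform_eventually[OF tendsto_const])
        (auto simp: eventually_at_filter flat_fn_def intro!: always_eventually)
    ultimately have "((\<lambda>h. flat_fn p h / h) \<longlongrightarrow> 0) (at 0)"
      by (simp add: filterlim_split_at)
    then show ?thesis using 3 by (simp add: DERIV_def flat_fn_def)
  qed
qed

lemma Ck_on_flat_fn:
  assumes "open S" "Ck_on k S f"
  shows "Ck_on k S (\<lambda>x. flat_fn p (f x))"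
proof -
  let ?\<psi> = "\<lambda>n. flat_fn ((flat_deriv ^^ n) p)"
  have "Ck_on k S (\<lambda>x. ?\<psi> 0 (f x))"
  proof (rule Ck_on_compose[where T = UNIV and \<psi> = ?\<psi>, OF assms(1) _ assms(2)])
    show "(?\<psi> n has_real_derivative ?\<psi> (Suc n) y) (at y)" for n y
      using flat_fn_has_derivative[of "(flat_deriv ^^ n) p" y] by simp
  qed simp
  then show ?thesis by simp
qed

section \<open>Smooth functions on a manifold\<close>

text \<open>The manifold is the whole type \<open>'m\<close>; functions are smooth on subsets \<open>W\<close>, meant to be open.\<close>

locale manifold =
  fixes M :: "('m::{t2_space,second_countable_topology}, 'b::real_inner, 'z) mfd_scheme"
  assumes manifold: "is_manifold M"
begin

lemmas manifold_facts = manifold[unfolded is_manifold_def]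

lemma cvec_orthonormal:
  "i < mdim M \<Longrightarrow> j < mdim M \<Longrightarrow> cvec M i \<bullet> cvec M j = (if i = j then 1 else 0)"
  using manifold_facts[THEN conjunct1] by simp

lemma span_cvec: "span (cvec M ` {..<mdim M}) = UNIV"
  by (rule manifold_facts[THEN conjunct2, THEN conjunct1])

lemma chart_at: obtains U \<kappa> where "(U, \<kappa>) \<in> charts M" "x \<in> U"
proof -
  have "x \<in> (\<Union>(U, \<kappa>)\<in>charts M. U)"
    unfolding manifold_facts[THEN conjunct2, THEN conjunct2, THEN conjunct1] by simp
  then show thesis using that by auto
qed

lemma chart_homeomorphism:
  assumes "(U, \<kappa>) \<in> charts M"
  shows "open U" "open (\<kappa> ` U)" "homeomorphism U (\<kappa> ` U) \<kappa> (the_inv_into U \<kappa>)"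
  using manifold_facts[THEN conjunct2, THEN conjunct2, THEN conjunct2, THEN conjunct1] assms by auto

lemma chart_transition:
  assumes "(U, \<kappa>) \<in> charts M" "(V, \<mu>) \<in> charts M"
  shows "smooth_on (\<kappa> ` (U \<inter> V)) (\<mu> \<circ> the_inv_into U \<kappa>)"
  using manifold_facts[THEN conjunct2, THEN conjunct2, THEN conjunct2, THEN conjunct2] assms by auto

lemma chart_inv:
  assumes "(U, \<kappa>) \<in> charts M" "x \<in> U"
  shows "the_inv_into U \<kappa> (\<kappa> x) = x"
  using chart_homeomorphism(3)[OF assms(1)] assms(2) by (simp add: homeomorphism_def)

lemma chart_inj_on:
  assumes "(U, \<kappa>) \<in> charts M"
  shows "inj_on \<kappa> U"
  using chart_inv[OF assms] by (rule inj_on_inverseI)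

lemma chart_image_open:
  assumes "(U, \<kappa>) \<in> charts M" "open W"
  shows "open (\<kappa> ` (U \<inter> W))"
proof -
  note h = chart_homeomorphism[OF assms(1)]
  have "openin (top_of_set (\<kappa> ` U)) (\<kappa> ` (U \<inter> W))"
    using homeomorphism_imp_open_map[OF h(3)] assms(2) by (simp add: openin_open_Int)
  then show ?thesis using h(2) by (rule openin_open_trans)
qed

lemma smooth_fn_iff:
  "smooth_fn M W f \<longleftrightarrow>
     (\<forall>U \<kappa> k. (U, \<kappa>) \<in> charts M \<longrightarrow> Ck_on k (\<kappa> ` (U \<inter> W)) (\<lambda>y. f (the_inv_into U \<kappa> y)))"
  by (auto simp: smooth_fn_def smooth_on_def comp_def)

lemma smooth_fnI:
  assumes "\<And>U \<kappa> k. (U, \<kappa>) \<in> charts M \<Longrightarrow> Ck_on k (\<kappa> ` (U \<inter> W)) (\<lambda>y. f (the_inv_into U \<kappa> y))"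
  shows "smooth_fn M W f"
  using assms by (simp add: smooth_fn_iff)

lemma smooth_fnD:
  assumes "smooth_fn M W f" "(U, \<kappa>) \<in> charts M"
  shows "Ck_on k (\<kappa> ` (U \<inter> W)) (\<lambda>y. f (the_inv_into U \<kappa> y))"
  using assms by (simp add: smooth_fn_iff)

lemma smooth_fn_subset: "smooth_fn M W f \<Longrightarrow> W' \<subseteq> W \<Longrightarrow> smooth_fn M W' f"
  by (rule smooth_fnI, rule Ck_on_subset[OF smooth_fnD]) auto

lemma smooth_fn_local:
  assumes "\<And>x. x \<in> W \<Longrightarrow> \<exists>T. open T \<and> x \<in> T \<and> smooth_fn M T f"
  shows "smooth_fn M W f"
proof (rule smooth_fnI)
  fix U \<kappa> k assume U: "(U, \<kappa>) \<in> charts M"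
  show "Ck_on k (\<kappa> ` (U \<inter> W)) (\<lambda>y. f (the_inv_into U \<kappa> y))"
  proof (rule Ck_on_local)
    fix y assume "y \<in> \<kappa> ` (U \<inter> W)"
    then obtain x where x: "x \<in> U" "x \<in> W" "y = \<kappa> x" by auto
    obtain T where T: "open T" "x \<in> T" "smooth_fn M T f" using assms[OF x(2)] by auto
    show "\<exists>S. open S \<and> y \<in> S \<and> Ck_on k S (\<lambda>y. f (the_inv_into U \<kappa> y))"
      using chart_image_open[OF U T(1)] x T(2) smooth_fnD[OF T(3) U]
      by (intro exI[of _ "\<kappa> ` (U \<inter> T)"]) auto
  qed
qed

lemma smooth_fn_cong:
  assumes "open W" "\<And>x. x \<in> W \<Longrightarrow> f x = g x"
  shows "smooth_fn M W f \<longleftrightarrow> smooth_fn M W g"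
proof -
  have "Ck_on k (\<kappa> ` (U \<inter> W)) (\<lambda>y. f (the_inv_into U \<kappa> y)) \<longleftrightarrow>
      Ck_on k (\<kappa> ` (U \<inter> W)) (\<lambda>y. g (the_inv_into U \<kappa> y))" if "(U, \<kappa>) \<in> charts M" for U \<kappa> k
    using chart_image_open[OF that assms(1)] chart_inv[OF that] assms(2)
    by (intro Ck_on_cong) auto
  then show ?thesis unfolding smooth_fn_iff by blast
qed

lemma smooth_fn_const: "smooth_fn M W (\<lambda>x. c)"
  by (simp add: smooth_fn_iff Ck_on_const)

lemma smooth_fn_add:
  assumes "open W" "smooth_fn M W f" "smooth_fn M W g"
  shows "smooth_fn M W (\<lambda>x. f x + g x)"
proof (rule smooth_fnI)
  fix U \<kappa> k assume U: "(U, \<kappa>) \<in> charts M"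
  show "Ck_on k (\<kappa> ` (U \<inter> W)) (\<lambda>y. f (the_inv_into U \<kappa> y) + g (the_inv_into U \<kappa> y))"
    by (rule Ck_on_add[OF chart_image_open[OF U assms(1)] smooth_fnD[OF assms(2) U] smooth_fnD[OF assms(3) U]])
qed

lemma smooth_fn_mult:
  assumes "open W" "smooth_fn M W f" "smooth_fn M W g"
  shows "smooth_fn M W (\<lambda>x. f x * g x)"
proof (rule smooth_fnI)
  fix U \<kappa> k assume U: "(U, \<kappa>) \<in> charts M"
  show "Ck_on k (\<kappa> ` (U \<inter> W)) (\<lambda>y. f (the_inv_into U \<kappa> y) * g (the_inv_into U \<kappa> y))"
    by (rule Ck_on_mult[OF chart_image_open[OF U assms(1)] smooth_fnD[OF assms(2) U] smooth_fnD[OF assms(3) U]])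
qed

lemma smooth_fn_uminus: "open W \<Longrightarrow> smooth_fn M W f \<Longrightarrow> smooth_fn M W (\<lambda>x. - f x)"
  using smooth_fn_mult[of W "\<lambda>x. -1" f] smooth_fn_const by simp

lemma smooth_fn_diff:
  "open W \<Longrightarrow> smooth_fn M W f \<Longrightarrow> smooth_fn M W g \<Longrightarrow> smooth_fn M W (\<lambda>x. f x - g x)"
  using smooth_fn_add[of W f "\<lambda>x. - g x"] smooth_fn_uminus by simp

lemma smooth_fn_sum:
  assumes "open W" "\<And>i. i \<in> I \<Longrightarrow> smooth_fn M W (f i)"
  shows "smooth_fn M W (\<lambda>x. \<Sum>i\<in>I. f i x)"
  using assms(2)
proof (induction I rule: infinite_finite_induct)
  case (insert i I)
  then show ?case using smooth_fn_add[OF assms(1), of "f i" "\<lambda>x. \<Sum>i\<in>I. f i x"] by simp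
qed (simp_all add: smooth_fn_const)

lemma smooth_fn_powr_minus_half:
  assumes "open W" "smooth_fn M W f" "\<And>x. x \<in> W \<Longrightarrow> f x > 0"
  shows "smooth_fn M W (\<lambda>x. f x powr (- 1/2))"
proof (rule smooth_fnI)
  fix U \<kappa> k assume U: "(U, \<kappa>) \<in> charts M"
  show "Ck_on k (\<kappa> ` (U \<inter> W)) (\<lambda>y. f (the_inv_into U \<kappa> y) powr (- 1/2))"
    by (rule Ck_on_powr_minus_half[OF chart_image_open[OF U assms(1)] smooth_fnD[OF assms(2) U]])
      (use chart_inv[OF U] assms(3) in auto)
qed

lemma smooth_fn_flat_fn:
  assumes "open W" "smooth_fn M W f"
  shows "smooth_fn M W (\<lambda>x. flat_fn p (f x))"
proof (rule smooth_fnI)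
  fix U \<kappa> k assume U: "(U, \<kappa>) \<in> charts M"
  show "Ck_on k (\<kappa> ` (U \<inter> W)) (\<lambda>y. flat_fn p (f (the_inv_into U \<kappa> y)))"
    by (rule Ck_on_flat_fn[OF chart_image_open[OF U assms(1)] smooth_fnD[OF assms(2) U]])
qed

lemma smooth_fn_chart_coordinate:
  assumes "(V, \<mu>) \<in> charts M"
  shows "smooth_fn M V (\<lambda>x. \<mu> x \<bullet> b)"
proof (rule smooth_fnI)
  fix U \<kappa> k assume U: "(U, \<kappa>) \<in> charts M"
  have "smooth_on (\<kappa> ` (U \<inter> V)) (\<mu> \<circ> the_inv_into U \<kappa>)"
    using U assms by (rule chart_transition)
  then have "Ck_on k (\<kappa> ` (U \<inter> V)) (\<lambda>y. \<mu> (the_inv_into U \<kappa> y))"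
    by (simp add: smooth_on_def comp_def)
  with chart_image_open[OF U chart_homeomorphism(1)[OF assms]]
  show "Ck_on k (\<kappa> ` (U \<inter> V)) (\<lambda>y. \<mu> (the_inv_into U \<kappa> y) \<bullet> b)"
    by (rule Ck_on_inner_left)
qed

lemma smooth_fn_continuous_on:
  assumes "open W" "smooth_fn M W f"
  shows "continuous_on W f"
proof -
  have "isCont f x" if x: "x \<in> W" for x
  proof -
    obtain U \<kappa> where U: "(U, \<kappa>) \<in> charts M" "x \<in> U" by (rule chart_at)
    have "Ck_on 0 (\<kappa> ` (U \<inter> W)) (\<lambda>y. f (the_inv_into U \<kappa> y))"
      by (rule smooth_fnD[OF assms(2) U(1)])
    moreover have "continuous_on (U \<inter> W) \<kappa>"
      by (rule continuous_on_subset[OF homeomorphism_cont1[OF chart_homeomorphism(3)[OF U(1)]]]) simp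
    ultimately have "continuous_on (U \<inter> W) (\<lambda>x. f (the_inv_into U \<kappa> (\<kappa> x)))"
      by (auto intro: continuous_on_compose2)
    then have "continuous_on (U \<inter> W) f"
      by (rule continuous_on_eq) (simp add: chart_inv[OF U(1)])
    then show ?thesis
      using U x chart_homeomorphism(1)[OF U(1)] assms(1) by (simp add: continuous_on_eq_continuous_at open_Int)
  qed
  then show ?thesis by (simp add: continuous_at_imp_continuous_on)
qed

text \<open>
  The model space is an inner product space spanned by finitely many vectors, so that its closed
  balls are compact: each lies in a cube, which is an image of a compact box of coefficients.
\<close>

lemma cvec_expansion: "(\<Sum>i<mdim M. (z \<bullet> cvec M i) *\<^sub>R cvec M i) = z"
proof -
  let ?S = "{z. (\<Sum>i<mdim M. (z \<bullet> cvec M i) *\<^sub>R cvec M i) = z}"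
  have "subspace ?S"
    by (auto intro!: subspaceI
        simp: inner_add_left scaleR_add_left sum.distrib simp flip: scaleR_scaleR scaleR_sum_right)
  moreover have "cvec M j \<in> ?S" if "j < mdim M" for j
    using that by (simp add: cvec_orthonormal if_distrib[of "\<lambda>c. c *\<^sub>R _"] sum.delta' cong: if_cong)
  ultimately have "span (cvec M ` {..<mdim M}) \<subseteq> ?S"
    by (intro span_minimal) auto
  then show ?thesis using span_cvec by auto
qed

lemma compact_cball_model: "compact (cball (z::'b) \<rho>)"
proof -
  have cube: "compact {\<Sum>i<n. c i *\<^sub>R v i | c. \<forall>i<n. \<bar>c i\<bar> \<le> \<rho>}" for n and v :: "nat \<Rightarrow> 'b"
  proof (induction n)
    case (Suc n)
    let ?C = "\<lambda>n. {\<Sum>i<n. c i *\<^sub>R v i | c. \<forall>i<n. \<bar>c i\<bar> \<le> \<rho>}"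
    let ?g = "\<lambda>(s, t). s + t *\<^sub>R v n"
    have "?C (Suc n) = ?g ` (?C n \<times> {-\<rho>..\<rho>})" (is "?L = ?R")
    proof
      show "?L \<subseteq> ?R"
      proof
        fix w assume "w \<in> ?L"
        then obtain c where c: "w = (\<Sum>i<Suc n. c i *\<^sub>R v i)" "\<forall>i<Suc n. \<bar>c i\<bar> \<le> \<rho>" by auto
        then have "(\<Sum>i<n. c i *\<^sub>R v i) \<in> ?C n" "c n \<in> {-\<rho>..\<rho>}"
          by (auto simp: abs_le_iff)
        with c(1) show "w \<in> ?R" by (auto intro!: image_eqI[of _ _ "(\<Sum>i<n. c i *\<^sub>R v i, c n)"])
      qed
      show "?R \<subseteq> ?L"
      proof clarsimp
        fix c t assume "- \<rho> \<le> t" "t \<le> \<rho>" "\<forall>i<n. \<bar>c i\<bar> \<le> \<rho>"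
        then show "\<exists>c'. (\<Sum>i<n. c i *\<^sub>R v i) + t *\<^sub>R v n = (\<Sum>i<n. c' i *\<^sub>R v i) + c' n *\<^sub>R v n \<and>
            (\<forall>i<Suc n. \<bar>c' i\<bar> \<le> \<rho>)"
          by (intro exI[of _ "c(n := t)"]) (auto simp: less_Suc_eq)
      qed
    qed
    moreover have "continuous_on (?C n \<times> {-\<rho>..\<rho>}) ?g"
      by (auto simp: case_prod_beta intro!: continuous_intros)
    then have "compact ?R"
      by (rule compact_continuous_image[OF _ compact_Times[OF Suc.IH compact_Icc]])
    ultimately show ?case by simp
  qed simp
  let ?C = "{\<Sum>i<mdim M. c i *\<^sub>R cvec M i | c. \<forall>i<mdim M. \<bar>c i\<bar> \<le> \<rho>}"
  have "cball 0 \<rho> \<subseteq> ?C"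
  proof
    fix w :: 'b assume "w \<in> cball 0 \<rho>"
    moreover have "\<bar>w \<bullet> cvec M i\<bar> \<le> norm w" if "i < mdim M" for i
    proof -
      have "norm (cvec M i) = 1"
        using that by (simp add: norm_eq_1 cvec_orthonormal)
      then show ?thesis using Cauchy_Schwarz_ineq2[of w "cvec M i"] by simp
    qed
    ultimately have "\<forall>i<mdim M. \<bar>w \<bullet> cvec M i\<bar> \<le> \<rho>" by fastforce
    then show "w \<in> ?C"
      by (intro CollectI exI[of _ "\<lambda>i. w \<bullet> cvec M i"] conjI cvec_expansion[symmetric])
  qed
  then have "cball (0::'b) \<rho> = ?C \<inter> cball 0 \<rho>" by blast
  moreover have "compact (?C \<inter> cball 0 \<rho>)" by (rule compact_Int_closed[OF cube closed_cball])
  ultimately have "compact (cball (0::'b) \<rho>)" by simp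
  then have "compact ((+) z ` cball 0 \<rho>)" by (intro compact_translation)
  then show ?thesis by simp
qed

text \<open>Bump functions; the support is contained in the closed set \<open>K\<close>.\<close>

lemma exists_bump:
  assumes "open W" "x \<in> W"
  obtains f K where "smooth_fn M UNIV f" "closed K" "K \<subseteq> W" "f x = 1" "\<And>y. y \<notin> K \<Longrightarrow> f y = 0"
proof -
  obtain V \<mu> where V: "(V, \<mu>) \<in> charts M" "x \<in> V" by (rule chart_at)
  let ?inv = "the_inv_into V \<mu>"
  \<comment> \<open>\<open>q\<close> is the squared distance to \<open>\<mu> x\<close>, written in coordinates because those are smooth.\<close>
  have "open (\<mu> ` (V \<inter> W))" by (rule chart_image_open[OF V(1) assms(1)])
  moreover have "\<mu> x \<in> \<mu> ` (V \<inter> W)" using V(2) assms(2) by blast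
  ultimately obtain \<rho> where \<rho>: "\<rho> > 0" "cball (\<mu> x) \<rho> \<subseteq> \<mu> ` (V \<inter> W)"
    unfolding open_contains_cball by blast
  define K where "K = ?inv ` cball (\<mu> x) \<rho>"
  define q where "q y = (\<Sum>i<mdim M. (\<mu> y \<bullet> cvec M i - \<mu> x \<bullet> cvec M i) * (\<mu> y \<bullet> cvec M i - \<mu> x \<bullet> cvec M i))" for y
  have q: "q y = (dist (\<mu> x) (\<mu> y))\<^sup>2" for y
  proof -
    let ?z = "\<mu> y - \<mu> x"
    have "?z \<bullet> ?z = ?z \<bullet> (\<Sum>i<mdim M. (?z \<bullet> cvec M i) *\<^sub>R cvec M i)" by (simp add: cvec_expansion)
    also have "\<dots> = q y" by (simp add: q_def inner_sum_right inner_diff_left)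
    finally show ?thesis 
      by (simp add: dist_norm power2_norm_eq_inner inner_diff_left inner_diff_right inner_commute)
  qed
  define f where "f y = (if y \<in> V then flat_fn 1 (\<rho>\<^sup>2 - q y) * (1 / flat_fn 1 (\<rho>\<^sup>2)) else 0)" for y
  have "continuous_on (cball (\<mu> x) \<rho>) ?inv"
  proof (rule continuous_on_subset)
    show "continuous_on (\<mu> ` V) ?inv"
      using chart_homeomorphism(3)[OF V(1)] by (rule homeomorphism_cont2)
    show "cball (\<mu> x) \<rho> \<subseteq> \<mu> ` V" using \<rho>(2) by auto
  qed
  then have "compact K"
    unfolding K_def by (rule compact_continuous_image[OF _ compact_cball_model])
  then have K: "closed K" by (rule compact_imp_closed)
  have KVW: "K \<subseteq> V \<inter> W"
    using \<rho>(2) chart_inv[OF V(1)] unfolding K_def by fastforce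
  have f0: "f y = 0" if "y \<notin> K" for y
  proof (cases "y \<in> V")
    case True
    then have "\<mu> y \<notin> cball (\<mu> x) \<rho>"
      using that image_eqI[of y ?inv "\<mu> y"] chart_inv[OF V(1) True] unfolding K_def by auto
    then have "\<rho>\<^sup>2 - q y < 0" using \<rho>(1) by (simp add: q power_strict_mono)
    then show ?thesis by (simp add: f_def flat_fn_def)
  qed (simp add: f_def)
  have "open V" by (rule chart_homeomorphism(1)[OF V(1)])
  have c: "smooth_fn M V (\<lambda>y. \<mu> y \<bullet> cvec M i - \<mu> x \<bullet> cvec M i)" for i
    by (rule smooth_fn_diff[OF \<open>open V\<close> smooth_fn_chart_coordinate[OF V(1)]]) (rule smooth_fn_const)
  have qV: "smooth_fn M V q"
    unfolding q_def
  proof (rule smooth_fn_sum[OF \<open>open V\<close>])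
    fix i
    show "smooth_fn M V (\<lambda>y. (\<mu> y \<bullet> cvec M i - \<mu> x \<bullet> cvec M i) * (\<mu> y \<bullet> cvec M i - \<mu> x \<bullet> cvec M i))"
      using smooth_fn_mult[OF \<open>open V\<close> c[of i] c[of i]] .
  qed
  have "smooth_fn M V (\<lambda>y. \<rho>\<^sup>2 - q y)"
    by (rule smooth_fn_diff[OF \<open>open V\<close> _ qV]) (rule smooth_fn_const)
  from smooth_fn_flat_fn[OF \<open>open V\<close> this, of 1]
  have "smooth_fn M V (\<lambda>y. flat_fn 1 (\<rho>\<^sup>2 - q y) * (1 / flat_fn 1 (\<rho>\<^sup>2)))"
    by (rule smooth_fn_mult[OF \<open>open V\<close>]) (rule smooth_fn_const)
  then have fV: "smooth_fn M V f"
    using smooth_fn_cong[OF \<open>open V\<close>, of f "\<lambda>y. flat_fn 1 (\<rho>\<^sup>2 - q y) * (1 / flat_fn 1 (\<rho>\<^sup>2))"]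
    by (simp add: f_def)
  have "open (- K)" using K by auto
  then have fK: "smooth_fn M (- K) f"
    using smooth_fn_cong[of "- K" f "\<lambda>y. 0"] smooth_fn_const f0 by auto
  have "smooth_fn M UNIV f"
  proof (rule smooth_fn_local)
    fix y :: 'm
    show "\<exists>T. open T \<and> y \<in> T \<and> smooth_fn M T f"
      using fV fK \<open>open V\<close> \<open>open (- K)\<close> KVW by (cases "y \<in> V") auto
  qed
  moreover have "f x = 1" using V(2) \<rho>(1) by (simp add: f_def q flat_fn_def)
  ultimately show thesis using that[of f K] K KVW f0 by blast
qed

end

section \<open>Frames and smooth sections\<close>

text \<open>The vectors \<open>b 0, \<dots>, b (r - 1)\<close> are pairwise distinct and form a basis of \<open>F\<close>.\<close>

definition indexed_basis :: "nat \<Rightarrow> (nat \<Rightarrow> 'v::real_vector) \<Rightarrow> 'v set \<Rightarrow> bool" where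
  "indexed_basis r b F \<longleftrightarrow>
     inj_on b {..<r} \<and> independent (b ` {..<r}) \<and> span (b ` {..<r}) = F"

lemma pointwise_frame_iff:
  "pointwise_frame E U r e \<longleftrightarrow> (\<forall>x\<in>U. indexed_basis r (\<lambda>a. e a x) (fib E x))"
  by (simp add: pointwise_frame_def indexed_basis_def)

lemma indexed_basis_expansion:
  assumes "indexed_basis r b F" "v \<in> F"
  shows "(\<Sum>a<r. representation (b ` {..<r}) v (b a) *\<^sub>R b a) = v"
proof -
  have "(\<Sum>w\<in>b ` {..<r}. representation (b ` {..<r}) v w *\<^sub>R w) = v"
    using assms by (intro sum_representation_eq) (auto simp: indexed_basis_def)
  then show ?thesis
    using assms(1) by (simp add: sum.reindex indexed_basis_def)
qed

lemma indexed_basis_representation: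
  assumes "indexed_basis r b F" "a < r"
  shows "representation (b ` {..<r}) (\<Sum>k<r. c k *\<^sub>R b k) (b a) = c a"
proof -
  have i: "independent (b ` {..<r})" and inj: "inj_on b {..<r}"
    using assms(1) by (auto simp: indexed_basis_def)
  have m: "b k \<in> span (b ` {..<r})" if "k < r" for k
    using that by (intro span_base) auto
  have "representation (b ` {..<r}) (\<Sum>k<r. c k *\<^sub>R b k) =
      (\<lambda>w. \<Sum>k<r. representation (b ` {..<r}) (c k *\<^sub>R b k) w)"
    by (rule representation_sum[OF i]) (simp add: m span_scale)
  then have "representation (b ` {..<r}) (\<Sum>k<r. c k *\<^sub>R b k) (b a) =
      (\<Sum>k<r. c k * representation (b ` {..<r}) (b k) (b a))"
    using m by (simp add: representation_scale[OF i])
  also have "\<dots> = (\<Sum>k<r. if k = a then c k else 0)"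
    using assms(2) inj
    by (intro sum.cong) (auto simp: representation_basis[OF i] inj_on_eq_iff)
  finally show ?thesis using assms(2) by simp
qed

lemma indexed_basis_indep:
  assumes "indexed_basis r b F" "(\<Sum>k<r. c k *\<^sub>R b k) = 0" "a < r"
  shows "c a = 0"
  using indexed_basis_representation[OF assms(1,3), of c] assms
  by (simp add: representation_zero indexed_basis_def)

text \<open>In a space with a basis of \<open>r\<close> vectors, any \<open>r\<close> spanning vectors form a basis.\<close>

lemma indexed_basis_of_spanning:
  assumes b: "indexed_basis r b F"
    and b': "\<And>a. a < r \<Longrightarrow> b' a \<in> F" "\<And>a. a < r \<Longrightarrow> b a \<in> span (b' ` {..<r})"
  shows "indexed_basis r b' F"
proof -
  let ?B = "b ` {..<r}" and ?B' = "b' ` {..<r}"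
  have B: "independent ?B" "span ?B = F" "card ?B = r"
    using b by (auto simp: indexed_basis_def card_image)
  have "subspace F" using B(2) by (metis subspace_span)
  have "span ?B' \<subseteq> F" using b'(1) \<open>subspace F\<close> by (intro span_minimal) auto
  moreover have "F \<subseteq> span ?B'" using b'(2) B(2) by (metis image_subsetI lessThan_iff span_minimal subspace_span)
  ultimately have span: "span ?B' = F" by blast
  have ge: "r \<le> card A" if "finite A" "?B' \<subseteq> span A" for A
  proof -
    have "?B \<subseteq> span A"
      using span B(2) that(2) by (metis span_minimal span_superset subspace_span subset_trans)
    then show ?thesis
      using independent_span_bound[OF that(1) B(1)] B(3) by simp
  qed
  have card: "card ?B' = r"
    using ge[OF _ span_superset] card_image_le[of "{..<r}" b'] by (simp add: le_antisym)
  moreover have "independent ?B'"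
  proof
    assume "dependent ?B'"
    then obtain w where w: "w \<in> ?B'" "w \<in> span (?B' - {w})" by (auto simp: dependent_def)
    have "?B' \<subseteq> span (?B' - {w})"
      using w(2) by (auto intro: span_base)
    then have "r \<le> card (?B' - {w})" by (intro ge) auto
    moreover have "card (?B' - {w}) < card ?B'" using w(1) by (intro card_Diff1_less) auto
    ultimately show False using card by simp
  qed
  ultimately show ?thesis using span by (simp add: indexed_basis_def eq_card_imp_inj_on)
qed

locale vector_bundle =
  fixes E :: "('m::{t2_space,second_countable_topology}, 'b::real_inner, 'v::real_vector, 'z) vbundle_scheme"
  assumes vector_bundle: "is_vector_bundle E"
begin

sublocale manifold E
  using vector_bundle by unfold_locales (simp add: is_vector_bundle_def)

lemmas vector_bundle_facts = vector_bundle[unfolded is_vector_bundle_def, THEN conjunct2]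

lemma subspace_fib: "subspace (fib E x)"
  using vector_bundle_facts by simp

lemma bframe_at: obtains U r e where "(U, r, e) \<in> bframes E" "x \<in> U"
proof -
  have "x \<in> (\<Union>(U, r, e)\<in>bframes E. U)"
    unfolding vector_bundle_facts[THEN conjunct2, THEN conjunct1] by simp
  then show thesis using that by auto
qed

lemma bframe_smooth_frame: "(U, r, e) \<in> bframes E \<Longrightarrow> smooth_frame E U r e"
  using vector_bundle_facts[THEN conjunct2, THEN conjunct2] by auto

lemma smooth_frame_basis:
  "smooth_frame E U r e \<Longrightarrow> x \<in> U \<Longrightarrow> indexed_basis r (\<lambda>a. e a x) (fib E x)"
  by (simp add: smooth_frame_def pointwise_frame_iff)

lemma frame_expansion:
  assumes "smooth_frame E U r e" "x \<in> U" "v \<in> fib E x"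
  shows "(\<Sum>a<r. frame_coeff r e x v a *\<^sub>R e a x) = v"
  using indexed_basis_expansion[OF smooth_frame_basis[OF assms(1,2)] assms(3)]
  by (simp add: frame_coeff_def)

lemma frame_coeff_add:
  assumes "smooth_frame E U r e" "x \<in> U" "v \<in> fib E x" "w \<in> fib E x"
  shows "frame_coeff r e x (v + w) a = frame_coeff r e x v a + frame_coeff r e x w a"
  using smooth_frame_basis[OF assms(1,2)] assms(3,4)
  by (simp add: frame_coeff_def indexed_basis_def representation_add)

lemma frame_coeff_scale:
  assumes "smooth_frame E U r e" "x \<in> U" "v \<in> fib E x"
  shows "frame_coeff r e x (c *\<^sub>R v) a = c * frame_coeff r e x v a"
  using smooth_frame_basis[OF assms(1,2)] assms(3)
  by (simp add: frame_coeff_def indexed_basis_def representation_scale)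

lemma frame_coeff_zero: "smooth_frame E U r e \<Longrightarrow> x \<in> U \<Longrightarrow> frame_coeff r e x 0 a = 0"
  by (simp add: frame_coeff_def representation_zero)

lemma smooth_section_onI:
  assumes "\<And>x. x \<in> W \<Longrightarrow> u x \<in> fib E x"
    and "\<And>U r e a. (U, r, e) \<in> bframes E \<Longrightarrow> a < r \<Longrightarrow> smooth_fn E (U \<inter> W) (\<lambda>x. frame_coeff r e x (u x) a)"
  shows "smooth_section_on E W u"
  using assms by (auto simp: smooth_section_on_def)

lemma smooth_section_onD:
  assumes "smooth_section_on E W u"
  shows "x \<in> W \<Longrightarrow> u x \<in> fib E x"
    and "(U, r, e) \<in> bframes E \<Longrightarrow> a < r \<Longrightarrow> smooth_fn E (U \<inter> W) (\<lambda>x. frame_coeff r e x (u x) a)"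
  using assms by (auto simp: smooth_section_on_def)

lemma smooth_section_on_subset:
  assumes "smooth_section_on E W u" "W' \<subseteq> W"
  shows "smooth_section_on E W' u"
proof (rule smooth_section_onI)
  fix U r e a assume "(U, r, e) \<in> bframes E" "a < r"
  from smooth_section_onD(2)[OF assms(1) this]
  show "smooth_fn E (U \<inter> W') (\<lambda>x. frame_coeff r e x (u x) a)"
    by (rule smooth_fn_subset) (use assms(2) in auto)
qed (use smooth_section_onD(1)[OF assms(1)] assms(2) in auto)

lemma bframe_open: "(U, r, e) \<in> bframes E \<Longrightarrow> open U"
  using bframe_smooth_frame by (simp add: smooth_frame_def)

lemma smooth_section_on_local:
  assumes "\<And>x. x \<in> W \<Longrightarrow> \<exists>T. open T \<and> x \<in> T \<and> smooth_section_on E T u"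
  shows "smooth_section_on E W u"
proof (rule smooth_section_onI)
  fix x assume "x \<in> W"
  from assms[OF this] show "u x \<in> fib E x" using smooth_section_onD(1) by blast
next
  fix U r e a assume U: "(U, r, e) \<in> bframes E" "a < r"
  show "smooth_fn E (U \<inter> W) (\<lambda>x. frame_coeff r e x (u x) a)"
  proof (rule smooth_fn_local)
    fix x assume x: "x \<in> U \<inter> W"
    then obtain T where T: "open T" "x \<in> T" "smooth_section_on E T u" using assms[of x] by blast
    show "\<exists>T. open T \<and> x \<in> T \<and> smooth_fn E T (\<lambda>x. frame_coeff r e x (u x) a)"
      using smooth_section_onD(2)[OF T(3) U] bframe_open[OF U(1)] T x
      by (intro exI[of _ "U \<inter> T"]) auto
  qed
qed

lemma smooth_section_on_cong:
  assumes "open W" "\<And>x. x \<in> W \<Longrightarrow> u x = v x" "smooth_section_on E W u"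
  shows "smooth_section_on E W v"
proof (rule smooth_section_onI)
  fix x assume "x \<in> W"
  then show "v x \<in> fib E x" using assms(2) smooth_section_onD(1)[OF assms(3)] by metis
next
  fix U r e a assume U: "(U, r, e) \<in> bframes E" "a < r"
  have "open (U \<inter> W)" using bframe_open[OF U(1)] assms(1) by auto
  then have "smooth_fn E (U \<inter> W) (\<lambda>x. frame_coeff r e x (u x) a) =
    smooth_fn E (U \<inter> W) (\<lambda>x. frame_coeff r e x (v x) a)"
    by (rule smooth_fn_cong) (simp add: assms(2))
  then show "smooth_fn E (U \<inter> W) (\<lambda>x. frame_coeff r e x (v x) a)"
    using smooth_section_onD(2)[OF assms(3) U] by simp
qed

lemma smooth_section_on_zero:
  assumes "open W"
  shows "smooth_section_on E W (\<lambda>x. 0)"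
proof (rule smooth_section_onI)
  fix U r e a assume U: "(U, r, e) \<in> bframes E" "a < r"
  have "open (U \<inter> W)" using bframe_open[OF U(1)] assms(1) by auto
  then have "smooth_fn E (U \<inter> W) (\<lambda>x. frame_coeff r e x 0 a) = smooth_fn E (U \<inter> W) (\<lambda>x. 0)"
    by (rule smooth_fn_cong) (simp add: frame_coeff_zero[OF bframe_smooth_frame[OF U(1)]])
  then show "smooth_fn E (U \<inter> W) (\<lambda>x. frame_coeff r e x 0 a)"
    by (simp add: smooth_fn_const)
qed (simp add: subspace_0 subspace_fib)

lemma smooth_section_on_add:
  assumes "open W" and u: "smooth_section_on E W u" and v: "smooth_section_on E W v"
  shows "smooth_section_on E W (\<lambda>x. u x + v x)"
proof (rule smooth_section_onI)
  fix x assume "x \<in> W"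
  then show "u x + v x \<in> fib E x"
    using smooth_section_onD(1)[OF u] smooth_section_onD(1)[OF v] subspace_fib by (simp add: subspace_add)
next
  fix U r e a assume U: "(U, r, e) \<in> bframes E" "a < r"
  have o: "open (U \<inter> W)" using bframe_open[OF U(1)] assms(1) by auto
  then have "smooth_fn E (U \<inter> W) (\<lambda>x. frame_coeff r e x (u x + v x) a) =
      smooth_fn E (U \<inter> W) (\<lambda>x. frame_coeff r e x (u x) a + frame_coeff r e x (v x) a)"
    by (rule smooth_fn_cong)
      (use smooth_section_onD(1)[OF u] smooth_section_onD(1)[OF v] in
        \<open>simp add: frame_coeff_add[OF bframe_smooth_frame[OF U(1)]]\<close>)
  then show "smooth_fn E (U \<inter> W) (\<lambda>x. frame_coeff r e x (u x + v x) a)"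
    using smooth_fn_add[OF o smooth_section_onD(2)[OF u U] smooth_section_onD(2)[OF v U]] by simp
qed

lemma smooth_section_on_scale:
  assumes "open W" and f: "smooth_fn E W f" and u: "smooth_section_on E W u"
  shows "smooth_section_on E W (\<lambda>x. f x *\<^sub>R u x)"
proof (rule smooth_section_onI)
  fix x assume "x \<in> W"
  then show "f x *\<^sub>R u x \<in> fib E x"
    using smooth_section_onD(1)[OF u] subspace_fib by (simp add: subspace_scale)
next
  fix U r e a assume U: "(U, r, e) \<in> bframes E" "a < r"
  have o: "open (U \<inter> W)" using bframe_open[OF U(1)] assms(1) by auto
  have f': "smooth_fn E (U \<inter> W) f" by (rule smooth_fn_subset[OF f]) simp
  have "smooth_fn E (U \<inter> W) (\<lambda>x. frame_coeff r e x (f x *\<^sub>R u x) a) =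
      smooth_fn E (U \<inter> W) (\<lambda>x. f x * frame_coeff r e x (u x) a)"
    by (rule smooth_fn_cong[OF o])
      (use smooth_section_onD(1)[OF u] in \<open>simp add: frame_coeff_scale[OF bframe_smooth_frame[OF U(1)]]\<close>)
  then show "smooth_fn E (U \<inter> W) (\<lambda>x. frame_coeff r e x (f x *\<^sub>R u x) a)"
    using smooth_fn_mult[OF o f' smooth_section_onD(2)[OF u U]] by simp
qed

lemma smooth_section_on_sum:
  assumes "open W" "\<And>i. i \<in> I \<Longrightarrow> smooth_section_on E W (u i)"
  shows "smooth_section_on E W (\<lambda>x. \<Sum>i\<in>I. u i x)"
  using assms(2)
proof (induction I rule: infinite_finite_induct)
  case (insert i I)
  then show ?case using smooth_section_on_add[OF assms(1), of "u i" "\<lambda>x. \<Sum>i\<in>I. u i x"] by simp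
qed (simp_all add: smooth_section_on_zero assms(1))

lemma sections_fib: "u \<in> sections E \<Longrightarrow> u x \<in> fib E x"
  using smooth_section_onD(1)[of UNIV u x] by (simp add: sections_def)

lemma sections_on: "u \<in> sections E \<Longrightarrow> smooth_section_on E W u"
  using smooth_section_on_subset[of UNIV u W] by (simp add: sections_def)

text \<open>
  Every vector is the value of a global section: extend it with constant coefficients in a local
  frame and cut off with a bump function. Pointwise identities can therefore be tested on sections.
\<close>

lemma exists_section:
  assumes "w \<in> fib E x"
  obtains s where "s \<in> sections E" "s x = w"
proof -
  obtain U r e where U: "(U, r, e) \<in> bframes E" "x \<in> U" by (rule bframe_at)
  note fr = bframe_smooth_frame[OF U(1)]
  obtain f K where f: "smooth_fn E UNIV f" "closed K" "K \<subseteq> U" "f x = 1" "\<And>y. y \<notin> K \<Longrightarrow> f y = 0"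
    using exists_bump[OF bframe_open[OF U(1)] U(2)] by metis
  define t where "t y = f y *\<^sub>R (\<Sum>a<r. frame_coeff r e x w a *\<^sub>R e a y)" for y
  define s where "s y = (if y \<in> U then t y else 0)" for y
  have "smooth_section_on E U (\<lambda>y. frame_coeff r e x w a *\<^sub>R e a y)" if "a < r" for a
    using smooth_section_on_scale[OF bframe_open[OF U(1)] smooth_fn_const, of "e a" "frame_coeff r e x w a"] fr that
    by (simp add: smooth_frame_def)
  then have "smooth_section_on E U (\<lambda>y. \<Sum>a<r. frame_coeff r e x w a *\<^sub>R e a y)"
    by (intro smooth_section_on_sum bframe_open[OF U(1)]) auto
  then have "smooth_section_on E U t"
    unfolding t_def
    by (rule smooth_section_on_scale[OF bframe_open[OF U(1)] smooth_fn_subset[OF f(1) subset_UNIV]])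
  then have sU: "smooth_section_on E U s"
    by (rule smooth_section_on_cong[OF bframe_open[OF U(1)], rotated]) (simp add: s_def)
  have "open (- K)" using f(2) by auto
  then have sK: "smooth_section_on E (- K) s"
    by (rule smooth_section_on_cong[OF _ _ smooth_section_on_zero]) (auto simp: s_def t_def f(5) \<open>open (- K)\<close>)
  have "smooth_section_on E UNIV s"
  proof (rule smooth_section_on_local)
    fix y :: 'm
    show "\<exists>T. open T \<and> y \<in> T \<and> smooth_section_on E T s"
      using sU sK bframe_open[OF U(1)] \<open>open (- K)\<close> f(3) by (cases "y \<in> U") auto
  qed
  moreover have "s x = w" using U(2) f(4) frame_expansion[OF fr U(2) assms] by (simp add: s_def t_def)
  ultimately show thesis using that by (simp add: sections_def)
qed

subsection \<open>Endomorphisms\<close>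

lemma endoD:
  assumes "is_endo E N"
  shows "u \<in> fib E x \<Longrightarrow> N x u \<in> fib E x"
    and "u \<in> fib E x \<Longrightarrow> v \<in> fib E x \<Longrightarrow> N x (u + v) = N x u + N x v"
    and "u \<in> fib E x \<Longrightarrow> N x (c *\<^sub>R u) = c *\<^sub>R N x u"
    and "(U, r, e) \<in> bframes E \<Longrightarrow> a < r \<Longrightarrow> smooth_section_on E U (\<lambda>x. N x (e a x))"
  using assms by (auto simp: is_endo_def)

lemma endo_zero: "is_endo E N \<Longrightarrow> N x 0 = 0"
  using endoD(3)[of N 0 x 0] subspace_0[OF subspace_fib] by simp

lemma endo_minus: "is_endo E N \<Longrightarrow> u \<in> fib E x \<Longrightarrow> N x (- u) = - N x u"
  using endoD(3)[of N u x "-1"] by simp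

lemma endo_sum:
  assumes "is_endo E N" "\<And>i. i \<in> I \<Longrightarrow> w i \<in> fib E x"
  shows "N x (\<Sum>i\<in>I. c i *\<^sub>R w i) = (\<Sum>i\<in>I. c i *\<^sub>R N x (w i))"
  using assms(2)
proof (induction I rule: infinite_finite_induct)
  case (insert i I)
  have "(\<Sum>i\<in>I. c i *\<^sub>R w i) \<in> fib E x" "c i *\<^sub>R w i \<in> fib E x"
    using insert.prems by (auto intro!: subspace_sum subspace_scale subspace_fib)
  then show ?case using insert by (simp add: endoD(2,3)[OF assms(1)])
qed (simp_all add: endo_zero[OF assms(1)])

text \<open>
  Smoothness of \<open>N\<close> is required on the distinguished frames only; it passes to all smooth sections
  by expanding them in such a frame.
\<close>

lemma smooth_section_on_endo:
  assumes "open W" and N: "is_endo E N" and u: "smooth_section_on E W u"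
  shows "smooth_section_on E W (endo_app N u)"
proof (rule smooth_section_on_local)
  fix x assume x: "x \<in> W"
  obtain U r e where U: "(U, r, e) \<in> bframes E" "x \<in> U" by (rule bframe_at)
  note fr = bframe_smooth_frame[OF U(1)]
  have o: "open (U \<inter> W)" using bframe_open[OF U(1)] assms(1) by auto
  have "smooth_section_on E (U \<inter> W) (\<lambda>y. frame_coeff r e y (u y) a *\<^sub>R N y (e a y))" if "a < r" for a
    by (intro smooth_section_on_scale o smooth_section_onD(2)[OF u U(1) that]
        smooth_section_on_subset[OF endoD(4)[OF N U(1) that]]) simp
  then have sm: "smooth_section_on E (U \<inter> W) (\<lambda>y. \<Sum>a<r. frame_coeff r e y (u y) a *\<^sub>R N y (e a y))"
    by (intro smooth_section_on_sum o) simp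
  have eq: "(\<Sum>a<r. frame_coeff r e y (u y) a *\<^sub>R N y (e a y)) = endo_app N u y" if y: "y \<in> U \<inter> W" for y
  proof -
    have "e a y \<in> fib E y" if "a < r" for a
      using fr y that smooth_section_onD(1) unfolding smooth_frame_def by blast
    then have "(\<Sum>a<r. frame_coeff r e y (u y) a *\<^sub>R N y (e a y)) =
        N y (\<Sum>a<r. frame_coeff r e y (u y) a *\<^sub>R e a y)"
      by (subst endo_sum[OF N]) auto
    also have "(\<Sum>a<r. frame_coeff r e y (u y) a *\<^sub>R e a y) = u y"
      using y smooth_section_onD(1)[OF u] by (intro frame_expansion[OF fr]) auto
    finally show ?thesis by (simp add: endo_app_def)
  qed
  have "smooth_section_on E (U \<inter> W) (endo_app N u)"
    by (rule smooth_section_on_cong[OF o eq sm])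
  then show "\<exists>T. open T \<and> x \<in> T \<and> smooth_section_on E T (endo_app N u)"
    using o U(2) x by blast
qed

lemma sections_endo: "is_endo E N \<Longrightarrow> u \<in> sections E \<Longrightarrow> endo_app N u \<in> sections E"
  using smooth_section_on_endo[of UNIV N u] by (simp add: sections_def)

lemma is_endo_scale:
  assumes "is_endo E N"
  shows "is_endo E (\<lambda>x v. c *\<^sub>R N x v)"
proof -
  have "smooth_section_on E U (\<lambda>x. c *\<^sub>R N x (e a x))" if "(U, r, e) \<in> bframes E" "a < r" for U r e a
    by (rule smooth_section_on_scale[OF bframe_open[OF that(1)] smooth_fn_const endoD(4)[OF assms that]])
  then show ?thesis
    using endoD(1,2,3)[OF assms] subspace_fib
    by (auto simp: is_endo_def subspace_scale scaleR_add_right)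
qed

lemma is_endo_compose:
  assumes "is_endo E N" "is_endo E N'"
  shows "is_endo E (\<lambda>x v. N x (N' x v))"
proof -
  have "smooth_section_on E U (\<lambda>x. N x (N' x (e a x)))" if "(U, r, e) \<in> bframes E" "a < r" for U r e a
    using smooth_section_on_endo[OF bframe_open[OF that(1)] assms(1) endoD(4)[OF assms(2) that]]
    by (simp add: endo_app_def)
  then show ?thesis
    using endoD(1,2,3)[OF assms(1)] endoD(1,2,3)[OF assms(2)]
    by (auto simp: is_endo_def)
qed

end

section \<open>Orthonormal frames\<close>

locale pseudo_euclidean_bundle =
  fixes E :: "('m::{t2_space,second_countable_topology}, 'b::real_inner, 'v::real_vector, 'z) vbundle_scheme"
  assumes pseudo_euclidean_bundle: "is_pseudo_euclidean_bundle E"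
begin

sublocale vector_bundle E
  using pseudo_euclidean_bundle by unfold_locales (simp add: is_pseudo_euclidean_bundle_def)

lemmas form_facts = pseudo_euclidean_bundle[unfolded is_pseudo_euclidean_bundle_def, THEN conjunct2]

lemma form_commute: "u \<in> fib E x \<Longrightarrow> v \<in> fib E x \<Longrightarrow> form E x u v = form E x v u"
  using form_facts[THEN conjunct1] by blast

lemma form_add_left:
  "u \<in> fib E x \<Longrightarrow> v \<in> fib E x \<Longrightarrow> w \<in> fib E x \<Longrightarrow> form E x (u + v) w = form E x u w + form E x v w"
  using form_facts[THEN conjunct2, THEN conjunct1] by blast

lemma form_scale_left:
  "u \<in> fib E x \<Longrightarrow> v \<in> fib E x \<Longrightarrow> form E x (k *\<^sub>R u) v = k * form E x u v"
  using form_facts[THEN conjunct2, THEN conjunct2, THEN conjunct1] by blast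

lemma form_nondegenerate:
  "u \<in> fib E x \<Longrightarrow> (\<And>v. v \<in> fib E x \<Longrightarrow> form E x u v = 0) \<Longrightarrow> u = 0"
  using form_facts[THEN conjunct2, THEN conjunct2, THEN conjunct2, THEN conjunct1] by blast

lemma form_bframe:
  "(U, r, e) \<in> bframes E \<Longrightarrow> a < r \<Longrightarrow> b < r \<Longrightarrow> smooth_fn E U (\<lambda>x. form E x (e a x) (e b x))"
  using form_facts[THEN conjunct2, THEN conjunct2, THEN conjunct2, THEN conjunct2] by auto

lemma fib_add: "u \<in> fib E x \<Longrightarrow> v \<in> fib E x \<Longrightarrow> u + v \<in> fib E x"
  using subspace_add[OF subspace_fib] .

lemma fib_diff: "u \<in> fib E x \<Longrightarrow> v \<in> fib E x \<Longrightarrow> u - v \<in> fib E x"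
  using subspace_diff[OF subspace_fib] .

lemma fib_uminus: "u \<in> fib E x \<Longrightarrow> - u \<in> fib E x"
  using subspace_neg[OF subspace_fib] .

lemma fib_scale: "u \<in> fib E x \<Longrightarrow> k *\<^sub>R u \<in> fib E x"
  using subspace_scale[OF subspace_fib] .

lemma fib_sum: "(\<And>i. i \<in> I \<Longrightarrow> w i \<in> fib E x) \<Longrightarrow> (\<Sum>i\<in>I. w i) \<in> fib E x"
  using subspace_sum[OF subspace_fib] .

lemma form_zero_left: "v \<in> fib E x \<Longrightarrow> form E x 0 v = 0"
  using form_scale_left[of v x v 0] by simp

lemma form_add_right:
  assumes "u \<in> fib E x" "v \<in> fib E x" "w \<in> fib E x"
  shows "form E x w (u + v) = form E x w u + form E x w v"
  using assms form_add_left[OF assms] by (simp add: form_commute[of w] fib_add)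

lemma form_scale_right:
  assumes "u \<in> fib E x" "v \<in> fib E x"
  shows "form E x v (k *\<^sub>R u) = k * form E x v u"
  using assms form_scale_left[OF assms] by (simp add: form_commute[of v] fib_scale)

lemma form_diff_left:
  assumes "u \<in> fib E x" "v \<in> fib E x" "w \<in> fib E x"
  shows "form E x (u - v) w = form E x u w - form E x v w"
  using form_add_left[of u x "(-1) *\<^sub>R v" w] form_scale_left[of v x w "-1"] assms fib_uminus by simp

lemma form_diff_right:
  assumes "u \<in> fib E x" "v \<in> fib E x" "w \<in> fib E x"
  shows "form E x w (u - v) = form E x w u - form E x w v"
  using form_add_right[of u x "(-1) *\<^sub>R v" w] form_scale_right[of v x w "-1"] assms fib_uminus by simp

lemma form_minus_left:
  assumes "u \<in> fib E x" "v \<in> fib E x"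
  shows "form E x (- u) v = - form E x u v"
  using form_scale_left[of u x v "-1"] assms by simp

lemma form_minus_right:
  assumes "u \<in> fib E x" "v \<in> fib E x"
  shows "form E x v (- u) = - form E x v u"
  using form_scale_right[of u x v "-1"] assms by simp

lemma form_sum_left:
  assumes "\<And>i. i \<in> I \<Longrightarrow> w i \<in> fib E x" "v \<in> fib E x"
  shows "form E x (\<Sum>i\<in>I. k i *\<^sub>R w i) v = (\<Sum>i\<in>I. k i * form E x (w i) v)"
  using assms(1)
proof (induction I rule: infinite_finite_induct)
  case (insert i I)
  then show ?case
    using assms(2) by (simp add: form_add_left form_scale_left fib_scale fib_sum)
qed (simp_all add: form_zero_left assms(2))

lemma form_sum_right:
  assumes "\<And>i. i \<in> I \<Longrightarrow> w i \<in> fib E x" "v \<in> fib E x"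
  shows "form E x v (\<Sum>i\<in>I. k i *\<^sub>R w i) = (\<Sum>i\<in>I. k i * form E x v (w i))"
proof -
  have "(\<Sum>i\<in>I. k i *\<^sub>R w i) \<in> fib E x" using assms by (intro fib_sum fib_scale)
  then have "form E x v (\<Sum>i\<in>I. k i *\<^sub>R w i) = form E x (\<Sum>i\<in>I. k i *\<^sub>R w i) v"
    using assms(2) form_commute by blast
  also have "\<dots> = (\<Sum>i\<in>I. k i * form E x (w i) v)" using assms by (rule form_sum_left)
  also have "\<dots> = (\<Sum>i\<in>I. k i * form E x v (w i))"
    using assms form_commute by (intro sum.cong) auto
  finally show ?thesis .
qed

lemma smooth_frame_fib: "smooth_frame E U r e \<Longrightarrow> x \<in> U \<Longrightarrow> a < r \<Longrightarrow> e a x \<in> fib E x"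
  using smooth_section_onD(1) unfolding smooth_frame_def by blast

lemma form_eq_0_on_frame:
  assumes "smooth_frame E U r e" "x \<in> U" "u \<in> fib E x" "\<And>a. a < r \<Longrightarrow> form E x u (e a x) = 0"
  shows "u = 0"
proof (rule form_nondegenerate[OF assms(3)])
  fix v assume v: "v \<in> fib E x"
  have "form E x u (\<Sum>a<r. frame_coeff r e x v a *\<^sub>R e a x) = 0"
    by (subst form_sum_right) (use assms smooth_frame_fib[OF assms(1,2)] in auto)
  then show "form E x u v = 0" by (simp add: frame_expansion[OF assms(1,2) v])
qed

lemma form_eq_on_frame:
  assumes "smooth_frame E U r e" "x \<in> U" "u \<in> fib E x" "v \<in> fib E x"
    and "\<And>a. a < r \<Longrightarrow> form E x u (e a x) = form E x v (e a x)"
  shows "u = v"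
proof -
  have "u - v = 0"
    by (rule form_eq_0_on_frame[OF assms(1,2)])
      (use assms smooth_frame_fib[OF assms(1,2)] in \<open>auto simp: form_diff_left fib_diff\<close>)
  then show ?thesis by simp
qed

lemma smooth_fn_form:
  assumes "open W" and u: "smooth_section_on E W u" and v: "smooth_section_on E W v"
  shows "smooth_fn E W (\<lambda>x. form E x (u x) (v x))"
proof (rule smooth_fn_local)
  fix x assume x: "x \<in> W"
  obtain U r e where U: "(U, r, e) \<in> bframes E" "x \<in> U" by (rule bframe_at)
  note fr = bframe_smooth_frame[OF U(1)]
  have o: "open (U \<inter> W)" using bframe_open[OF U(1)] assms(1) by auto
  let ?g = "\<lambda>y. \<Sum>a<r. \<Sum>b<r. frame_coeff r e y (u y) a * (frame_coeff r e y (v y) b * form E y (e a y) (e b y))"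
  have "smooth_fn E (U \<inter> W) (\<lambda>y. frame_coeff r e y (u y) a *
      (frame_coeff r e y (v y) b * form E y (e a y) (e b y)))" if "a < r" "b < r" for a b
    using smooth_fn_mult[OF o smooth_section_onD(2)[OF u U(1) that(1)]
        smooth_fn_mult[OF o smooth_section_onD(2)[OF v U(1) that(2)]
          smooth_fn_subset[OF form_bframe[OF U(1) that] Int_lower1]]] .
  then have "smooth_fn E (U \<inter> W) ?g"
    by (intro smooth_fn_sum[OF o]) auto
  moreover have "?g y = form E y (u y) (v y)" if y: "y \<in> U \<inter> W" for y
  proof -
    have e: "e a y \<in> fib E y" if "a < r" for a using smooth_frame_fib[OF fr] y that by auto
    have uv: "u y \<in> fib E y" "v y \<in> fib E y"
      using y smooth_section_onD(1)[OF u] smooth_section_onD(1)[OF v] by auto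
    have "form E y (u y) (v y) = form E y (\<Sum>a<r. frame_coeff r e y (u y) a *\<^sub>R e a y) (v y)"
      using frame_expansion[OF fr _ uv(1)] y by simp
    also have "\<dots> = (\<Sum>a<r. frame_coeff r e y (u y) a * form E y (e a y) (v y))"
      using e uv by (intro form_sum_left) auto
    also have "\<dots> = (\<Sum>a<r. frame_coeff r e y (u y) a *
        form E y (e a y) (\<Sum>b<r. frame_coeff r e y (v y) b *\<^sub>R e b y))"
      using frame_expansion[OF fr _ uv(2)] y by simp
    also have "\<dots> = (\<Sum>a<r. frame_coeff r e y (u y) a *
        (\<Sum>b<r. frame_coeff r e y (v y) b * form E y (e a y) (e b y)))"
      using e by (intro sum.cong arg_cong2[where f = "(*)"] form_sum_right) auto
    also have "\<dots> = ?g y" by (simp add: sum_distrib_left)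
    finally show ?thesis by simp
  qed
  ultimately have "smooth_fn E (U \<inter> W) (\<lambda>y. form E y (u y) (v y))"
    using smooth_fn_cong[OF o, of ?g "\<lambda>y. form E y (u y) (v y)"] by simp
  then show "\<exists>T. open T \<and> x \<in> T \<and> smooth_fn E T (\<lambda>y. form E y (u y) (v y))"
    using o U(2) x by blast
qed

lemma smooth_frame_subset:
  assumes "smooth_frame E U r e" "open V" "V \<subseteq> U"
  shows "smooth_frame E V r e"
  using assms smooth_section_on_subset[OF _ assms(3)]
  by (auto simp: smooth_frame_def pointwise_frame_def)

text \<open>
  One step of the Gram-Schmidt procedure. The form may be indefinite, so \<open>f k\<close> may be isotropic at
  the given point; adding \<open>f l\<close> or \<open>- f l\<close> with \<open>\<langle>f k, f l\<rangle> \<noteq> 0\<close> repairs this.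
\<close>

lemma orthonormal_step:
  assumes fr: "smooth_frame E V r f" and x0: "x0 \<in> V" and k: "k < r"
    and orth: "\<And>y a b. y \<in> V \<Longrightarrow> a < k \<Longrightarrow> b < r \<Longrightarrow>
      form E y (f a y) (f b y) = (if a = b then \<epsilon> a else 0)"
    and \<epsilon>: "\<And>a. a < k \<Longrightarrow> \<epsilon> a * \<epsilon> a = 1"
  obtains V' f' \<epsilon>' where "smooth_frame E V' r f'" "x0 \<in> V'" "V' \<subseteq> V"
    "\<And>y a b. y \<in> V' \<Longrightarrow> a < Suc k \<Longrightarrow> b < r \<Longrightarrow>
      form E y (f' a y) (f' b y) = (if a = b then \<epsilon>' a else 0)"
    "\<And>a. a < Suc k \<Longrightarrow> \<epsilon>' a * \<epsilon>' a = (1::real)"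
proof -
  have oV: "open V" using fr by (simp add: smooth_frame_def)
  have ff: "f a y \<in> fib E y" if "y \<in> V" "a < r" for y a using smooth_frame_fib[OF fr that] .
  have fs: "smooth_section_on E V (f a)" if "a < r" for a using fr that by (simp add: smooth_frame_def)
  let ?F = "\<lambda>a b. form E x0 (f a x0) (f b x0)"
  obtain l t where l: "k \<le> l" "l < r" "t = 0 \<or> k < l"
    and ne: "form E x0 (f k x0 + t *\<^sub>R f l x0) (f k x0 + t *\<^sub>R f l x0) \<noteq> 0"
  proof (cases "?F k k = 0")
    case False
    then show thesis using that[of k 0] k by simp
  next
    case True
    have "\<exists>l<r. ?F k l \<noteq> 0"
    proof (rule ccontr)
      assume "\<not> (\<exists>l<r. ?F k l \<noteq> 0)"
      then have "f k x0 = 0"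
        using form_eq_0_on_frame[OF fr x0 ff[OF x0 k]] by blast
      then show False
        using indexed_basis_indep[OF smooth_frame_basis[OF fr x0], of "\<lambda>j. if j = k then 1 else 0" k] k
        by (simp add: if_distrib[of "\<lambda>c. c *\<^sub>R _"] cong: if_cong)
    qed
    then obtain l where l: "l < r" "?F k l \<noteq> 0" by blast
    have "\<not> l < k"
      using orth[OF x0 _ k, of l] l form_commute[OF ff[OF x0 k] ff[OF x0 l(1)]] by auto
    moreover have "l \<noteq> k" using l(2) True by auto
    ultimately have kl: "k < l" by simp
    have "form E x0 (f k x0 + t *\<^sub>R f l x0) (f k x0 + t *\<^sub>R f l x0) = 2 * t * ?F k l + t * t * ?F l l" for t
      using ff[OF x0 k] ff[OF x0 l(1)] True form_commute[OF ff[OF x0 k] ff[OF x0 l(1)]]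
      by (simp add: form_add_left form_add_right form_scale_left form_scale_right fib_scale fib_add algebra_simps)
    then have "form E x0 (f k x0 + 1 *\<^sub>R f l x0) (f k x0 + 1 *\<^sub>R f l x0) \<noteq> 0 \<or>
        form E x0 (f k x0 + (-1) *\<^sub>R f l x0) (f k x0 + (-1) *\<^sub>R f l x0) \<noteq> 0"
      using l(2) by (simp only:) (auto simp: algebra_simps)
    then show thesis using that kl l(1) by (metis less_imp_le)
  qed
  \<comment> \<open>The new \<open>k\<close>-th frame section is \<open>g\<close> normalised by \<open>s\<close>, and the later ones are made orthogonal to it;
    \<open>\<sigma>\<close> is the sign of \<open>\<langle>g, g\<rangle>\<close>, which is constant on \<open>V'\<close>.\<close>
  define g where "g y = f k y + t *\<^sub>R f l y" for y
  have gf: "g y \<in> fib E y" if "y \<in> V" for y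
    unfolding g_def using ff that k l by (intro fib_add fib_scale) auto
  have gs: "smooth_section_on E V g"
    unfolding g_def
    by (rule smooth_section_on_add[OF oV fs[OF k]
          smooth_section_on_scale[OF oV smooth_fn_const[of V t] fs[OF l(2)]]])
  define \<sigma> where "\<sigma> = sgn (form E x0 (g x0) (g x0))"
  have \<sigma>: "\<sigma> * \<sigma> = 1" using ne by (simp add: \<sigma>_def g_def sgn_mult_self_eq)
  define G where "G y = \<sigma> * form E y (g y) (g y)" for y
  have Gs: "smooth_fn E V G"
    unfolding G_def by (rule smooth_fn_mult[OF oV _ smooth_fn_form[OF oV gs gs]]) (rule smooth_fn_const)
  define V' where "V' = V \<inter> G -` {0<..}"
  have oV': "open V'"
    unfolding V'_def using smooth_fn_continuous_on[OF oV Gs] oV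
    by (intro continuous_open_preimage) auto
  have "G x0 > 0" using ne by (simp add: G_def \<sigma>_def g_def sgn_mult_self_eq abs_sgn_eq sgn_if)
  then have x0': "x0 \<in> V'" using x0 by (simp add: V'_def)
  have V'V: "V' \<subseteq> V" by (simp add: V'_def)
  have Gp: "G y > 0" if "y \<in> V'" for y using that by (simp add: V'_def)
  define s where "s y = G y powr (- 1/2)" for y
  have ss: "smooth_fn E V' s"
    unfolding s_def by (rule smooth_fn_powr_minus_half[OF oV' smooth_fn_subset[OF Gs V'V] Gp])
  have s2: "s y * s y * G y = 1" "s y > 0" if "y \<in> V'" for y
  proof -
    have "s y * s y = G y powr (-1)" by (simp add: s_def flip: powr_add)
    then show "s y * s y * G y = 1" using Gp[OF that] by (simp add: powr_minus)
    show "s y > 0" using Gp[OF that] by (simp add: s_def)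
  qed
  define c where "c b y = form E y (f b y) (g y) * (\<sigma> * (s y * s y))" for b y
  have cg: "c b y * form E y (g y) (g y) = form E y (f b y) (g y)" if "y \<in> V'" for b y
  proof -
    have "c b y * form E y (g y) (g y) = form E y (f b y) (g y) * (s y * s y * G y)"
      by (simp add: c_def G_def)
    then show ?thesis using s2(1)[OF that] by simp
  qed
  have gs': "smooth_section_on E V' g" by (rule smooth_section_on_subset[OF gs V'V])
  have fs': "smooth_section_on E V' (f b)" if "b < r" for b by (rule smooth_section_on_subset[OF fs[OF that] V'V])
  have cs: "smooth_fn E V' (c b)" if "b < r" for b
  proof -
    have "smooth_fn E V' (\<lambda>y. \<sigma> * (s y * s y))"
      by (rule smooth_fn_mult[OF oV' _ smooth_fn_mult[OF oV' ss ss]]) (rule smooth_fn_const)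
    then show ?thesis
      unfolding c_def by (rule smooth_fn_mult[OF oV' smooth_fn_form[OF oV' fs'[OF that] gs']])
  qed
  define f' where "f' b y = (if b < k then f b y else if b = k then s y *\<^sub>R g y else f b y + (- c b y) *\<^sub>R g y)" for b y
  have f's: "smooth_section_on E V' (f' b)" if b: "b < r" for b
  proof -
    consider "b < k" | "b = k" | "b > k" by linarith
    then show ?thesis
    proof cases
      case 1
      then show ?thesis using fs'[OF b] by (simp add: f'_def[abs_def])
    next
      case 2
      then show ?thesis using smooth_section_on_scale[OF oV' ss gs'] by (simp add: f'_def[abs_def])
    next
      case 3
      then show ?thesis
        using smooth_section_on_add[OF oV' fs'[OF b]
            smooth_section_on_scale[OF oV' smooth_fn_uminus[OF oV' cs[OF b]] gs']]
        by (simp add: f'_def[abs_def])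
    qed
  qed
  have "indexed_basis r (\<lambda>a. f' a y) (fib E y)" if y: "y \<in> V'" for y
  proof (rule indexed_basis_of_spanning)
    show "indexed_basis r (\<lambda>a. f a y) (fib E y)" using smooth_frame_basis[OF fr] y V'V by blast
    show "f' a y \<in> fib E y" if "a < r" for a using smooth_section_onD(1)[OF f's[OF that] y] .
    let ?S = "span ((\<lambda>a. f' a y) ` {..<r})"
    have in_S: "f' a y \<in> ?S" if "a < r" for a using that by (intro span_base) auto
    have "(1 / s y) *\<^sub>R f' k y \<in> ?S" using in_S[OF k] by (rule span_scale)
    then have g: "g y \<in> ?S" using s2(2)[OF y] by (simp add: f'_def)
    have hi: "f a y \<in> ?S" if "k < a" "a < r" for a
    proof -
      have "f' a y + c a y *\<^sub>R g y \<in> ?S" using in_S[OF that(2)] g by (intro span_add span_scale)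
      then show ?thesis using that(1) by (simp add: f'_def)
    qed
    have "t *\<^sub>R f l y \<in> ?S" using l hi[of l] by (auto intro: span_scale span_zero)
    with g have "g y - t *\<^sub>R f l y \<in> ?S" by (rule span_diff)
    then have fk: "f k y \<in> ?S" by (simp add: g_def)
    fix a assume a: "a < r"
    consider "a < k" | "a = k" | "k < a" by linarith
    then show "f a y \<in> ?S"
      using in_S[OF a] hi[OF _ a] fk by cases (auto simp: f'_def)
  qed
  then have fr': "smooth_frame E V' r f'"
    using oV' f's by (simp add: smooth_frame_def pointwise_frame_iff)
  define \<epsilon>' where "\<epsilon>' a = (if a < k then \<epsilon> a else \<sigma>)" for a
  have "form E y (f' a y) (f' b y) = (if a = b then \<epsilon>' a else 0)"
    if y: "y \<in> V'" and a: "a < Suc k" and b: "b < r" for y a b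
  proof -
    have yV: "y \<in> V" using y V'V by auto
    note fb = ff[OF yV] and gy = gf[OF yV]
    have low: "form E y (f j y) (g y) = 0" if "j < k" for j
      using that l k fb orth[OF yV that k] orth[OF yV that l(2)]
      by (simp add: g_def form_add_right form_scale_right fib_scale)
    have low': "form E y (g y) (f j y) = 0" if "j < k" for j
      using low[OF that] form_commute[OF gy fb, of j] that k by simp
    have hi: "form E y (g y) (f b y + (- c b y) *\<^sub>R g y) = 0"
      using cg[OF y, of b] fb[OF b] gy form_commute[OF gy fb[OF b]]
      by (simp add: form_add_right form_scale_right fib_scale form_diff_right)
    have sg: "s y * (s y * form E y (g y) (g y)) = \<sigma>"
    proof -
      have "\<sigma> * (s y * s y * G y) = \<sigma> * \<sigma> * (s y * (s y * form E y (g y) (g y)))"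
        by (simp add: G_def)
      then show ?thesis using s2(1)[OF y] \<sigma> by simp
    qed
    show ?thesis
    proof (cases "a < k")
      case True
      then show ?thesis
        using orth[OF yV True b] low[OF True] fb[OF b] fb[of a] gy k
        by (auto simp: f'_def \<epsilon>'_def form_diff_right form_scale_right fib_scale)
    next
      case False
      then have a: "a = k" using a by simp
      consider "b < k" | "b = k" | "b > k" by linarith
      then show ?thesis
      proof cases
        case 1
        then show ?thesis using a low'[OF 1] gy fb[OF b] by (simp add: f'_def form_scale_left)
      next
        case 2
        then show ?thesis
          using a sg gy by (simp add: f'_def \<epsilon>'_def form_scale_left form_scale_right fib_scale)
      next
        case 3
        have "f b y + (- c b y) *\<^sub>R g y \<in> fib E y" using gy fb[OF b] by (intro fib_add fib_scale)
        then show ?thesis using 3 a hi gy by (simp add: f'_def form_scale_left)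
      qed
    qed
  qed
  moreover have "\<epsilon>' a * \<epsilon>' a = 1" for a using \<epsilon> \<sigma> by (simp add: \<epsilon>'_def)
  ultimately show thesis using that[OF fr' x0' V'V, of \<epsilon>'] by blast
qed

lemma exists_orthonormal_frame:
  obtains V r f \<epsilon> where "smooth_frame E V r f" "x \<in> V"
    "\<forall>y\<in>V. \<forall>a<r. \<forall>b<r. form E y (f a y) (f b y) = (if a = b then \<epsilon> a else 0)"
    "\<forall>a<r. \<epsilon> a * \<epsilon> a = (1::real)"
proof -
  obtain U r e where U: "(U, r, e) \<in> bframes E" "x \<in> U" by (rule bframe_at)
  note fr = bframe_smooth_frame[OF U(1)]
  have "\<exists>V f \<epsilon>. smooth_frame E V r f \<and> x \<in> V \<and>
     (\<forall>y a b. y \<in> V \<longrightarrow> a < k \<longrightarrow> b < r \<longrightarrow> form E y (f a y) (f b y) = (if a = b then \<epsilon> a else 0)) \<and>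
     (\<forall>a<k. \<epsilon> a * \<epsilon> a = (1::real))" if "k \<le> r" for k
    using that
  proof (induction k)
    case 0
    then show ?case using fr U(2) by auto
  next
    case (Suc k)
    then obtain V f \<epsilon> where *: "smooth_frame E V r f" "x \<in> V"
     "\<forall>y a b. y \<in> V \<longrightarrow> a < k \<longrightarrow> b < r \<longrightarrow> form E y (f a y) (f b y) = (if a = b then \<epsilon> a else 0)"
     "\<forall>a<k. \<epsilon> a * \<epsilon> a = (1::real)" by auto
    have "k < r" using Suc.prems by simp
    show ?case
    proof (rule orthonormal_step[OF *(1,2) \<open>k < r\<close>, of \<epsilon>])
      fix V' f' \<epsilon>'
      assume "smooth_frame E V' r f'" "x \<in> V'"
        "\<And>y a b. y \<in> V' \<Longrightarrow> a < Suc k \<Longrightarrow> b < r \<Longrightarrow> form E y (f' a y) (f' b y) = (if a = b then \<epsilon>' a else 0)"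
        "\<And>a. a < Suc k \<Longrightarrow> \<epsilon>' a * \<epsilon>' a = (1::real)"
      then show ?thesis by (intro exI[of _ V'] exI[of _ f'] exI[of _ \<epsilon>']) simp
    qed (use *(3,4) in auto)
  qed
  from this[OF order_refl] show thesis using that by metis
qed

text \<open>
  Frames with constant Gram matrix exist around every point, so \<open>coord_at E x\<close> is a coordinate system
  around \<open>x\<close>.
\<close>

lemma exists_coord: "\<exists>c\<in>coords E. x \<in> cdom c"
proof -
  obtain V r f \<epsilon> where V: "smooth_frame E V r f" "x \<in> V"
    "\<forall>y\<in>V. \<forall>a<r. \<forall>b<r. form E y (f a y) (f b y) = (if a = b then \<epsilon> a else 0)"
    "\<forall>a<r. \<epsilon> a * \<epsilon> a = (1::real)" by (rule exists_orthonormal_frame[of x])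
  obtain U \<kappa> where U: "(U, \<kappa>) \<in> charts E" "x \<in> U" by (rule chart_at)
  let ?c = "\<lparr>cdom = U \<inter> V, cchart = \<kappa>, crank = r, cframe = f\<rparr>"
  have "open (U \<inter> V)" using chart_homeomorphism(1)[OF U(1)] V(1) by (simp add: smooth_frame_def open_Int)
  then have "smooth_frame E (U \<inter> V) r f" using smooth_frame_subset[OF V(1)] by simp
  then have "?c \<in> coords E"
    using U V(3) by (auto simp: coords_def gram_def)
  then show ?thesis using U(2) V(2) by (intro bexI[of _ ?c]) auto
qed

text \<open>The form identifies the fibre with its dual space.\<close>

lemma exists_form_representative:
  assumes fr: "smooth_frame E U r e" and x: "x \<in> U"
  obtains w where "w \<in> fib E x" "\<And>a. a < r \<Longrightarrow> form E x w (e a x) = t a"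
proof -
  obtain V n f \<epsilon> where V: "smooth_frame E V n f" "x \<in> V"
    "\<forall>y\<in>V. \<forall>a<n. \<forall>b<n. form E y (f a y) (f b y) = (if a = b then \<epsilon> a else 0)"
    "\<forall>a<n. \<epsilon> a * \<epsilon> a = (1::real)" by (rule exists_orthonormal_frame[of x])
  note ff = smooth_frame_fib[OF V(1,2)]
  \<comment> \<open>\<open>L\<close> is the linear functional on the fibre with the prescribed values \<open>t a\<close> on \<open>e a x\<close>.\<close>
  define L where "L v = (\<Sum>a<r. frame_coeff r e x v a * t a)" for v
  define w where "w = (\<Sum>k<n. (\<epsilon> k * L (f k x)) *\<^sub>R f k x)"
  have w: "w \<in> fib E x" unfolding w_def using ff by (intro fib_sum fib_scale) auto
  have wf: "form E x w (f j x) = L (f j x)" if "j < n" for j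
  proof -
    have "form E x w (f j x) = (\<Sum>k<n. \<epsilon> k * L (f k x) * form E x (f k x) (f j x))"
      unfolding w_def using ff that by (intro form_sum_left) auto
    also have "\<dots> = (\<Sum>k<n. if k = j then \<epsilon> k * \<epsilon> k * L (f k x) else 0)"
      using V(2,3) that by (intro sum.cong) auto
    finally show ?thesis using that V(4) by simp
  qed
  have "form E x w (e a x) = t a" if a: "a < r" for a
  proof -
    let ?k = "frame_coeff n f x (e a x)"
    have ea: "(\<Sum>j<n. ?k j *\<^sub>R f j x) = e a x"
      using frame_expansion[OF V(1,2)] smooth_frame_fib[OF fr x a] by blast
    have co: "frame_coeff r e x (\<Sum>j\<in>J. ?k j *\<^sub>R f j x) b = (\<Sum>j\<in>J. ?k j * frame_coeff r e x (f j x) b)"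
      if "finite J" "J \<subseteq> {..<n}" for J b
      using that
    proof (induction J)
      case (insert j J)
      then have "(\<Sum>j\<in>J. ?k j *\<^sub>R f j x) \<in> fib E x" "f j x \<in> fib E x"
        using ff by (auto intro!: fib_sum fib_scale)
      with insert show ?case
        by (simp add: frame_coeff_add[OF fr x] frame_coeff_scale[OF fr x] fib_scale)
    qed (simp add: frame_coeff_zero[OF fr x])
    have eb: "e b x = (\<Sum>k<r. (if k = b then 1 else 0) *\<^sub>R e k x)" if "b < r" for b
      using that by (simp add: if_distrib[of "\<lambda>c. c *\<^sub>R _"] cong: if_cong)
    have "frame_coeff r e x (e a x) b = (if b = a then 1 else 0)" if "b < r" for b
      unfolding frame_coeff_def
      by (subst eb[OF a], rule indexed_basis_representation[OF smooth_frame_basis[OF fr x] that, simplified])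
    then have La: "L (e a x) = t a"
      using a by (simp add: L_def if_distrib[of "\<lambda>c. c * _"] cong: if_cong)
    have "form E x w (e a x) = form E x w (\<Sum>j<n. ?k j *\<^sub>R f j x)" by (simp add: ea)
    also have "\<dots> = (\<Sum>j<n. ?k j * form E x w (f j x))" using ff w by (intro form_sum_right) auto
    also have "\<dots> = (\<Sum>j<n. \<Sum>b<r. ?k j * frame_coeff r e x (f j x) b * t b)"
      using wf by (simp add: L_def sum_distrib_left mult.assoc)
    also have "\<dots> = (\<Sum>b<r. (\<Sum>j<n. ?k j * frame_coeff r e x (f j x) b) * t b)"
      by (subst sum.swap) (simp add: sum_distrib_right)
    also have "\<dots> = L (e a x)"
      using co[of "{..<n}"] by (simp add: L_def ea)
    finally show ?thesis using La by simp
  qed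
  with w show thesis using that by blast
qed

end

section \<open>Products and signs in low degree\<close>

lemma submultisets_empty: "{J'. J' \<subseteq># {#}} = {{#}}"
  by auto

lemma submultisets_single: "{J'. J' \<subseteq># {#j#}} = {{#}, {#j#}}"
proof -
  have "J' = {#} \<or> J' = {#j#}" if "J' \<subseteq># {#j#}" for J'
    using that by (metis mset_subset_eq_exists_conv single_is_union)
  then show ?thesis by auto
qed

lemma ksign_empty [simp]: "ksign {} K = 1" "ksign I {} = 1"
  by (simp_all add: ksign_def)

lemma ksign_single: "ksign {a} {b} = (if b < a then -1 else 1)"
proof -
  have "{(a', b'). a' \<in> {a} \<and> b' \<in> {b} \<and> b' < a'} = (if b < a then {(a, b)} else {})" by auto
  then show ?thesis by (simp add: ksign_def)
qed

lemma ksign_pair: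
  assumes "a \<noteq> b"
  shows "ksign {e} {a, b} = ksign {e} {a} * ksign {e} {b}"
proof -
  have "{(a', b'). a' \<in> {e} \<and> b' \<in> {a, b} \<and> b' < a'} =
      (if a < e then {(e, a)} else {}) \<union> (if b < e then {(e, b)} else {})" by auto
  then show ?thesis using assms by (simp add: ksign_def[of "{e}" "{a, b}"] ksign_single)
qed

lemma gmult_const: "gmult f g {} {#} = f {} {#} * g {} {#}"
  by (simp add: gmult_def submultisets_empty)

lemma gmult_tau: "gmult f g {a} {#} = f {} {#} * g {a} {#} + f {a} {#} * g {} {#}"
  by (simp add: gmult_def submultisets_empty Pow_insert)

lemma gmult_mom: "gmult f g {} {#j#} = f {} {#} * g {} {#j#} + f {} {#j#} * g {} {#}"
  by (simp add: gmult_def submultisets_single)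

lemma gmult_tau_tau:
  assumes "a \<noteq> b"
  shows "gmult f g {a, b} {#} = f {} {#} * g {a, b} {#} + ksign {a} {b} * f {a} {#} * g {b} {#} +
     ksign {b} {a} * f {b} {#} * g {a} {#} + f {a, b} {#} * g {} {#}"
proof -
  have "Pow {a, b} = {{}, {a}, {b}, {a, b}}" by (auto simp: Pow_insert)
  moreover have "{a, b} - {a} = {b}" "{a, b} - {b} = {a}" using assms by auto
  moreover have "{a} \<noteq> {a, b}" "{b} \<noteq> {a, b}" "{a} \<noteq> {b}" using assms by auto
  ultimately show ?thesis by (simp add: gmult_def submultisets_empty)
qed

section \<open>Calculus in local coordinates\<close>

text \<open>A coordinate system \<open>c\<close> and a point \<open>x\<close> of its domain.\<close>

locale local_coordinates = pseudo_euclidean_bundle E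
  for E :: "('m::{t2_space,second_countable_topology}, 'b::real_inner, 'v::real_vector, 'z) vbundle_scheme" +
  fixes c :: "('m, 'b, 'v) coord" and x :: 'm
  assumes coord: "c \<in> coords E" and point: "x \<in> cdom c"
begin

text \<open>The inverse \<open>g\<^sup>a\<^sup>b\<close> of the Gram matrix at \<open>x\<close>.\<close>

abbreviation g :: "nat \<Rightarrow> nat \<Rightarrow> real" where
  "g \<equiv> gram_inv E c x"

text \<open>The component \<open>u\<^sub>a = \<langle>u, e\<^sub>a\<rangle>\<close> as a function, and the component \<open>u\<^sup>b\<close> at the point \<open>x\<close>.\<close>

definition lower :: "('m \<Rightarrow> 'v) \<Rightarrow> nat \<Rightarrow> 'm \<Rightarrow> real" where
  "lower u a y = form E y (u y) (cframe c a y)"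

definition upper :: "('m \<Rightarrow> 'v) \<Rightarrow> nat \<Rightarrow> real" where
  "upper u b = (\<Sum>a<crank c. g a b * lower u a x)"

text \<open>The partial derivative \<open>\<partial>f/\<partial>q\<^sup>i\<close> at \<open>x\<close>.\<close>

abbreviation pd :: "nat \<Rightarrow> ('m \<Rightarrow> real) \<Rightarrow> real" where
  "pd i f \<equiv> cderiv E c i f x"

lemma coord_frame: "smooth_frame E (cdom c) (crank c) (cframe c)"
  using coord by (simp add: coords_def)

lemma coord_open: "open (cdom c)"
  using coord_frame by (simp add: smooth_frame_def)

lemma cframe_fib: "y \<in> cdom c \<Longrightarrow> a < crank c \<Longrightarrow> cframe c a y \<in> fib E y"
  using smooth_frame_fib[OF coord_frame] .

lemma gram_constant:
  assumes "y \<in> cdom c" "a < crank c" "b < crank c"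
  shows "gram E c y a b = gram E c x a b"
  using coord point assms unfolding coords_def by blast

lemma exists_dual_basis:
  assumes "y \<in> cdom c"
  obtains w where "\<forall>a. w a \<in> fib E y"
    "\<forall>a. \<forall>b<crank c. form E y (w a) (cframe c b y) = (if a = b then 1 else 0)"
proof -
  have "\<exists>w. w \<in> fib E y \<and> (\<forall>b<crank c. form E y w (cframe c b y) = (if a = b then 1 else 0))" for a
    using exists_form_representative[OF coord_frame assms, of "\<lambda>b. if a = b then 1 else 0"] by metis
  then have "\<exists>w. \<forall>a. w a \<in> fib E y \<and> (\<forall>b<crank c. form E y (w a) (cframe c b y) = (if a = b then 1 else 0))"
    by (intro choice allI)
  then obtain w where "\<forall>a. w a \<in> fib E y \<and> (\<forall>b<crank c. form E y (w a) (cframe c b y) = (if a = b then 1 else 0))" ..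
  then show thesis by (intro that[of w]) auto
qed

text \<open>The matrix \<open>gram_inv E c y\<close> is a left inverse of the Gram matrix: such a matrix exists and is unique.\<close>

lemma gram_inv_at:
  assumes "y \<in> cdom c"
  shows "a < crank c \<Longrightarrow> b < crank c \<Longrightarrow>
    (\<Sum>d<crank c. gram_inv E c y a d * form E y (cframe c d y) (cframe c b y)) = (if a = b then 1 else 0)"
proof -
  let ?r = "crank c"
  let ?P = "\<lambda>h :: nat \<Rightarrow> nat \<Rightarrow> real. (\<forall>a b. \<not> (a < ?r \<and> b < ?r) \<longrightarrow> h a b = 0) \<and>
     (\<forall>a<?r. \<forall>b<?r. (\<Sum>d<?r. h a d * gram E c y d b) = (if a = b then 1 else 0))"
  obtain w where w: "\<forall>a. w a \<in> fib E y"
    "\<forall>a. \<forall>b<?r. form E y (w a) (cframe c b y) = (if a = b then 1 else 0)"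
    by (rule exists_dual_basis[OF assms])
  have form_sum: "form E y (\<Sum>d<?r. k d *\<^sub>R cframe c d y) (cframe c b y) = (\<Sum>d<?r. k d * gram E c y d b)"
    if "b < ?r" for k b
    using cframe_fib[OF assms] that by (subst form_sum_left) (auto simp: gram_def)
  define h where "h a d = (if a < ?r \<and> d < ?r then frame_coeff ?r (cframe c) y (w a) d else 0)" for a d
  have "?P h"
  proof (intro conjI allI impI)
    fix a b assume ab: "a < ?r" "b < ?r"
    have "(\<Sum>d<?r. h a d * gram E c y d b) = form E y (\<Sum>d<?r. h a d *\<^sub>R cframe c d y) (cframe c b y)"
      using ab by (simp add: form_sum)
    also have "(\<Sum>d<?r. h a d *\<^sub>R cframe c d y) = w a"
      using frame_expansion[OF coord_frame assms w(1)[rule_format]] ab(1) by (simp add: h_def)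
    finally show "(\<Sum>d<?r. h a d * gram E c y d b) = (if a = b then 1 else 0)" using w(2) ab by simp
  qed (auto simp: h_def)
  moreover have "h' = h" if h': "?P h'" for h'
  proof (intro ext)
    fix a b
    show "h' a b = h a b"
    proof (cases "a < ?r \<and> b < ?r")
      case True
      let ?z = "\<Sum>d<?r. (h' a d - h a d) *\<^sub>R cframe c d y"
      have "?z = 0"
      proof (rule form_eq_0_on_frame[OF coord_frame assms])
        show "?z \<in> fib E y" using cframe_fib[OF assms] by (intro fib_sum fib_scale) auto
        show "form E y ?z (cframe c k y) = 0" if "k < ?r" for k
          using True that h' \<open>?P h\<close> by (simp add: form_sum left_diff_distrib sum_subtractf)
      qed
      then show ?thesis
        using indexed_basis_indep[OF smooth_frame_basis[OF coord_frame assms], of "\<lambda>d. h' a d - h a d" b] True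
        by simp
    next
      case False
      then show ?thesis using h' \<open>?P h\<close> by metis
    qed
  qed
  ultimately have "?P (THE h. ?P h)" by (rule theI)
  then have "?P (gram_inv E c y)" by (simp only: gram_inv_def)
  then show "a < ?r \<Longrightarrow> b < ?r \<Longrightarrow>
    (\<Sum>d<?r. gram_inv E c y a d * form E y (cframe c d y) (cframe c b y)) = (if a = b then 1 else 0)"
    by (simp add: gram_def)
qed

lemma g_inverse:
  assumes "y \<in> cdom c" "a < crank c" "b < crank c"
  shows "(\<Sum>d<crank c. g a d * form E y (cframe c d y) (cframe c b y)) = (if a = b then 1 else 0)"
proof -
  have "(\<Sum>d<crank c. g a d * form E y (cframe c d y) (cframe c b y)) =
      (\<Sum>d<crank c. g a d * form E x (cframe c d x) (cframe c b x))"
    using gram_constant[OF assms(1) _ assms(3)] by (simp add: gram_def)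
  then show ?thesis using gram_inv_at[OF point assms(2,3)] by simp
qed

text \<open>
  The dual frame \<open>e\<^sup>a = g\<^sup>a\<^sup>d e\<^sub>d\<close>. The coefficients are taken at \<open>x\<close>, which makes no difference since the
  Gram matrix is constant.
\<close>

definition dual :: "nat \<Rightarrow> 'm \<Rightarrow> 'v" where
  "dual a y = (\<Sum>d<crank c. g a d *\<^sub>R cframe c d y)"

lemma dual_fib: "y \<in> cdom c \<Longrightarrow> dual a y \<in> fib E y"
  unfolding dual_def using cframe_fib by (intro fib_sum fib_scale) auto

lemma form_dual:
  assumes "y \<in> cdom c" "a < crank c" "b < crank c"
  shows "form E y (dual a y) (cframe c b y) = (if a = b then 1 else 0)"
  unfolding dual_def using g_inverse[OF assms] cframe_fib[OF assms(1)] assms(3)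
  by (subst form_sum_left) auto

lemma g_symmetric:
  assumes "a < crank c" "b < crank c"
  shows "g a b = g b a"
proof -
  have *: "form E x (dual a x) (dual b x) = g b a" if ab: "a < crank c" "b < crank c" for a b
  proof -
    have "form E x (dual a x) (dual b x) = (\<Sum>d<crank c. g b d * form E x (dual a x) (cframe c d x))"
      unfolding dual_def[of b] using cframe_fib[OF point] dual_fib[OF point]
      by (subst form_sum_right) auto
    also have "\<dots> = (\<Sum>d<crank c. if d = a then g b d else 0)"
      using form_dual[OF point ab(1)] by (intro sum.cong) auto
    finally show ?thesis using ab by simp
  qed
  show ?thesis
    using *[OF assms] *[OF assms(2,1)] form_commute[OF dual_fib[OF point] dual_fib[OF point]] by simp
qed

lemma dual_expansion:
  assumes y: "y \<in> cdom c" and u: "u \<in> fib E y"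
  shows "u = (\<Sum>a<crank c. form E y u (cframe c a y) *\<^sub>R dual a y)" (is "u = ?w")
proof (rule form_eq_on_frame[OF coord_frame y u])
  show "?w \<in> fib E y" using dual_fib[OF y] by (intro fib_sum fib_scale)
  fix b assume b: "b < crank c"
  have "form E y ?w (cframe c b y) =
      (\<Sum>a<crank c. form E y u (cframe c a y) * form E y (dual a y) (cframe c b y))"
    using dual_fib[OF y] cframe_fib[OF y b] by (intro form_sum_left)
  also have "\<dots> = (\<Sum>a<crank c. if a = b then form E y u (cframe c a y) else 0)"
    using form_dual[OF y _ b] by (intro sum.cong) auto
  finally show "form E y u (cframe c b y) = form E y ?w (cframe c b y)" using b by simp
qed

lemma form_in_components:
  assumes y: "y \<in> cdom c" and u: "u \<in> fib E y" and v: "v \<in> fib E y"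
  shows "form E y u v = (\<Sum>a<crank c. \<Sum>b<crank c.
      g a b * (form E y u (cframe c a y) * form E y v (cframe c b y)))"
proof -
  have "form E y u v = (\<Sum>a<crank c. form E y u (cframe c a y) * form E y (dual a y) v)"
    by (subst dual_expansion[OF y u], rule form_sum_left) (use dual_fib[OF y] v in auto)
  also have "\<dots> = (\<Sum>a<crank c. form E y u (cframe c a y) *
      (\<Sum>b<crank c. g a b * form E y (cframe c b y) v))"
    unfolding dual_def using cframe_fib[OF y] v
    by (intro sum.cong arg_cong2[where f = "(*)"] form_sum_left) auto
  also have "\<dots> = (\<Sum>a<crank c. \<Sum>b<crank c.
      g a b * (form E y u (cframe c a y) * form E y v (cframe c b y)))"
    using form_commute[OF v cframe_fib[OF y]] by (simp add: sum_distrib_left mult_ac)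
  finally show ?thesis .
qed

lemma upper_alt: "b < crank c \<Longrightarrow> upper u b = (\<Sum>a<crank c. g b a * lower u a x)"
  unfolding upper_def using g_symmetric by (intro sum.cong) auto

lemma form_upper_left:
  assumes "u x \<in> fib E x" "w \<in> fib E x"
  shows "form E x (u x) w = (\<Sum>b<crank c. upper u b * form E x w (cframe c b x))"
proof -
  have "form E x (u x) w = (\<Sum>b<crank c. \<Sum>a<crank c.
      g a b * (form E x (u x) (cframe c a x) * form E x w (cframe c b x)))"
    by (subst form_in_components[OF point assms], rule sum.swap)
  also have "\<dots> = (\<Sum>b<crank c. upper u b * form E x w (cframe c b x))"
    by (simp add: upper_def lower_def sum_distrib_right mult.assoc)
  finally show ?thesis .
qed

lemma coord_chart:
  obtains V where "(V, cchart c) \<in> charts E" "cdom c \<subseteq> V"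
  using coord by (auto simp: coords_def)

lemma coord_inv: "y \<in> cdom c \<Longrightarrow> the_inv_into (cdom c) (cchart c) (cchart c y) = y"
  by (metis coord_chart chart_inj_on inj_on_subset the_inv_into_f_f)

lemma coord_image_open: "open (cchart c ` cdom c)"
proof -
  obtain V where V: "(V, cchart c) \<in> charts E" "cdom c \<subseteq> V" by (rule coord_chart)
  then have "V \<inter> cdom c = cdom c" by blast
  then show ?thesis using chart_image_open[OF V(1) coord_open] by simp
qed

lemma smooth_fn_coord_derivative:
  assumes "smooth_fn E (cdom c) f"
  shows "((f \<circ> the_inv_into (cdom c) (cchart c)) has_derivative
      frechet_derivative (f \<circ> the_inv_into (cdom c) (cchart c)) (at (cchart c x))) (at (cchart c x))"
proof -
  obtain V where V: "(V, cchart c) \<in> charts E" "cdom c \<subseteq> V" by (rule coord_chart)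
  then have "V \<inter> cdom c = cdom c" by blast
  then have "Ck_on (Suc 0) (cchart c ` cdom c) (\<lambda>z. f (the_inv_into V (cchart c) z))"
    using smooth_fnD[OF assms V(1), of "Suc 0"] by simp
  then have "((\<lambda>z. f (the_inv_into V (cchart c) z)) has_derivative
      frechet_derivative (\<lambda>z. f (the_inv_into V (cchart c) z)) (at (cchart c x))) (at (cchart c x))"
    by (rule Ck_on_SucD(1)) (use point in auto)
  then have "((f \<circ> the_inv_into (cdom c) (cchart c)) has_derivative
      frechet_derivative (\<lambda>z. f (the_inv_into V (cchart c) z)) (at (cchart c x))) (at (cchart c x))"
    by (rule has_derivative_transform_within_open[OF _ coord_image_open])
      (use point chart_inv[OF V(1)] V(2) coord_inv in auto)
  then show ?thesis by (metis frechet_derivative_at)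
qed

lemma pd_eqI:
  assumes "((f \<circ> the_inv_into (cdom c) (cchart c)) has_derivative D) (at (cchart c x))"
  shows "pd i f = D (cvec E i)"
  unfolding cderiv_def using frechet_derivative_at[OF assms] by simp

lemma pd_const: "pd i (\<lambda>y. k) = 0"
  by (rule pd_eqI) (simp add: comp_def)

lemma pd_cong:
  assumes "\<And>y. y \<in> cdom c \<Longrightarrow> f y = f' y" and f: "smooth_fn E (cdom c) f"
  shows "pd i f = pd i f'"
proof -
  have "((f' \<circ> the_inv_into (cdom c) (cchart c)) has_derivative
      frechet_derivative (f \<circ> the_inv_into (cdom c) (cchart c)) (at (cchart c x))) (at (cchart c x))"
    by (rule has_derivative_transform_within_open[OF smooth_fn_coord_derivative[OF f] coord_image_open])
      (use point coord_inv assms(1) in auto)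
  from pd_eqI[OF this] show ?thesis by (simp add: cderiv_def)
qed

lemma pd_mult:
  assumes "smooth_fn E (cdom c) f" "smooth_fn E (cdom c) f'"
  shows "pd i (\<lambda>y. f y * f' y) = f x * pd i f' + pd i f * f' x"
proof -
  note d = has_derivative_mult[OF smooth_fn_coord_derivative[OF assms(1)] smooth_fn_coord_derivative[OF assms(2)]]
  have "pd i (\<lambda>y. f y * f' y) =
      (f \<circ> the_inv_into (cdom c) (cchart c)) (cchart c x) * pd i f' +
      pd i f * (f' \<circ> the_inv_into (cdom c) (cchart c)) (cchart c x)"
    unfolding cderiv_def[of E c i f] cderiv_def[of E c i f']
    by (rule pd_eqI) (use d in \<open>simp add: comp_def\<close>)
  then show ?thesis by (simp add: coord_inv point)
qed

lemma pd_cmult: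
  assumes "smooth_fn E (cdom c) f"
  shows "pd i (\<lambda>y. k * f y) = k * pd i f"
  using pd_mult[OF smooth_fn_const[of "cdom c" k] assms, of i] by (simp add: pd_const)

lemma pd_sum:
  assumes "\<And>j. j \<in> I \<Longrightarrow> smooth_fn E (cdom c) (f j)"
  shows "pd i (\<lambda>y. \<Sum>j\<in>I. f j y) = (\<Sum>j\<in>I. pd i (f j))"
proof -
  have "((\<lambda>z. \<Sum>j\<in>I. (f j \<circ> the_inv_into (cdom c) (cchart c)) z) has_derivative
      (\<lambda>v. \<Sum>j\<in>I. frechet_derivative (f j \<circ> the_inv_into (cdom c) (cchart c)) (at (cchart c x)) v))
      (at (cchart c x))"
    using smooth_fn_coord_derivative[OF assms] by (rule has_derivative_sum)
  then show ?thesis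
    unfolding cderiv_def[of E c i "f _"]
    by (intro pd_eqI) (simp add: comp_def)
qed

lemma lower_smooth: "u \<in> sections E \<Longrightarrow> a < crank c \<Longrightarrow> smooth_fn E (cdom c) (lower u a)"
  unfolding lower_def[abs_def]
  using smooth_fn_form[OF coord_open sections_on, of u "cframe c a"] coord_frame
  by (simp add: smooth_frame_def)

lemma pairing_smooth: "u \<in> sections E \<Longrightarrow> v \<in> sections E \<Longrightarrow> smooth_fn E (cdom c) (pairing E u v)"
  unfolding pairing_def[abs_def] by (intro smooth_fn_form coord_open sections_on)

text \<open>The constancy of \<open>g\<^sup>a\<^sup>b\<close> enters here: no derivatives of the metric appear.\<close>

lemma pd_pairing:
  assumes u: "u \<in> sections E" and v: "v \<in> sections E"
  shows "pd i (pairing E u v) =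
    (\<Sum>b<crank c. upper u b * pd i (lower v b)) + (\<Sum>b<crank c. upper v b * pd i (lower u b))"
proof -
  let ?t = "\<lambda>a b y. g a b * (lower u a y * lower v b y)"
  have ls: "smooth_fn E (cdom c) (\<lambda>y. lower u a y * lower v b y)" if "a < crank c" "b < crank c" for a b
    by (rule smooth_fn_mult[OF coord_open lower_smooth[OF u that(1)] lower_smooth[OF v that(2)]])
  have ts: "smooth_fn E (cdom c) (?t a b)" if "a < crank c" "b < crank c" for a b
    by (rule smooth_fn_mult[OF coord_open _ ls[OF that]]) (rule smooth_fn_const)
  have ts': "smooth_fn E (cdom c) (\<lambda>y. \<Sum>b<crank c. ?t a b y)" if "a < crank c" for a
    by (rule smooth_fn_sum[OF coord_open]) (use ts that in auto)
  have "pd i (pairing E u v) = pd i (\<lambda>y. \<Sum>a<crank c. \<Sum>b<crank c. ?t a b y)"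
    by (rule pd_cong[OF _ pairing_smooth[OF u v]])
      (simp add: pairing_def lower_def form_in_components[OF _ sections_fib[OF u] sections_fib[OF v]])
  also have "\<dots> = (\<Sum>a<crank c. pd i (\<lambda>y. \<Sum>b<crank c. ?t a b y))"
    by (rule pd_sum) (use ts' in auto)
  also have "\<dots> = (\<Sum>a<crank c. \<Sum>b<crank c. pd i (?t a b))"
    by (intro sum.cong refl pd_sum) (use ts in auto)
  also have "\<dots> = (\<Sum>a<crank c. \<Sum>b<crank c.
      g a b * lower u a x * pd i (lower v b) + g a b * lower v b x * pd i (lower u a))"
    by (intro sum.cong refl)
      (simp add: pd_cmult[OF ls] pd_mult lower_smooth[OF u] lower_smooth[OF v] algebra_simps)
  also have "\<dots> = (\<Sum>b<crank c. \<Sum>a<crank c. g a b * lower u a x * pd i (lower v b)) +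
      (\<Sum>a<crank c. \<Sum>b<crank c. g a b * lower v b x * pd i (lower u a))"
    by (simp add: sum.distrib sum.swap[of "\<lambda>a b. g a b * lower u a x * pd i (lower v b)"])
  also have "\<dots> = (\<Sum>b<crank c. upper u b * pd i (lower v b)) + (\<Sum>a<crank c. upper v a * pd i (lower u a))"
    by (simp add: upper_def[of u] upper_alt[of _ v] sum_distrib_right)
  finally show ?thesis .
qed

end

section \<open>The Dorfman bracket in local coordinates\<close>

text \<open>
  The brackets at the point \<open>x\<close> depend on two kinds of coefficients of \<open>\<Theta>\<close>: those of \<open>\<tau>\<^sup>b p\<^sub>i\<close> and
  those of \<open>\<tau>\<^sup>d \<tau>\<^sup>a \<tau>\<^sup>b\<close>.
\<close>

locale local_cubic = local_coordinates E c x
  for E :: "('m::{t2_space,second_countable_topology}, 'b::real_inner, 'v::real_vector, 'z) vbundle_scheme"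
    and c :: "('m, 'b, 'v) coord" and x :: 'm +
  fixes \<Theta> :: "('m, 'b, 'v) gfn"
begin

text \<open>
  Up to sign, \<open>anc b i\<close> is the \<open>i\<close>-th component of the vector field that the anchor assigns to \<open>e\<^sub>b\<close>.
\<close>

definition anc :: "nat \<Rightarrow> nat \<Rightarrow> real" where
  "anc b i = \<Theta> c x {b} {#i#}"

text \<open>
  The totally skew array of coefficients of the part of \<open>\<Theta>\<close> that is cubic in \<open>\<tau>\<close>. The signs account for
  the increasing order of the generators in \<open>\<tau>\<^sup>I\<close>.
\<close>

definition skew3 :: "nat \<Rightarrow> nat \<Rightarrow> nat \<Rightarrow> real" where
  "skew3 d a b = (if d = a \<or> d = b \<or> a = b then 0
     else ksign {a} {b} * ksign {d} {a} * ksign {d} {b} * \<Theta> c x {d, a, b} {#})"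

text \<open>The function \<open>{u, \<Theta>}\<close>, whose Poisson bracket with \<open>v\<close> is \<open>[u, v]\<close>.\<close>

abbreviation ham :: "('m \<Rightarrow> 'v) \<Rightarrow> ('m, 'b, 'v) gfn" where
  "ham u \<equiv> pbracket E (of_section E u) \<Theta>"

lemma skew3_swap: "skew3 d b a = - skew3 d a b" "skew3 b a d = - skew3 d a b"
  by (auto simp: skew3_def ksign_single insert_commute)

lemma of_section_tau:
  "of_section E u c y {b} {#} = (if b < crank c then lower u b y else 0)"
proof -
  have "of_section E u c y {b} {#} = (\<Sum>a<crank c. if a = b then lower u a y else 0)"
    unfolding of_section_def by (intro sum.cong) (auto simp: gtau_def lower_def)
  then show ?thesis by simp
qed

lemma of_section_other:
  assumes "\<And>b. \<not> (I = {b} \<and> J = {#})"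
  shows "of_section E u c y I J = 0"
  unfolding of_section_def using assms by (intro sum.neutral) (auto simp: gtau_def)

lemma of_section_zeros [simp]:
  "of_section E u c y {} J = 0" "of_section E u c y I (add_mset i J) = 0"
  "a \<noteq> b \<Longrightarrow> of_section E u c y {a, b} J = 0"
  by (rule of_section_other; auto)+

lemma dmom_of_section [simp]: "dmom i (of_section E u c y) I J = 0"
  by (simp add: dmom_def)

lemma dtau_of_section:
  assumes "a < crank c"
  shows "dtau_right a (of_section E u c x) {} {#} = lower u a x"
    "dtau_left a (of_section E u c x) {} {#} = lower u a x"
  using assms by (simp_all add: dtau_right_def dtau_left_def of_section_tau)

lemma dtau_of_section_zeros:
  "dtau_right a (of_section E u c x) {b} {#} = 0"
  "dtau_left a (of_section E u c x) {b} {#} = 0"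
  "dtau_right a (of_section E u c x) {} {#i#} = 0"
  "b \<noteq> b' \<Longrightarrow> dtau_right a (of_section E u c x) {b, b'} {#} = 0"
  by (auto simp: dtau_right_def dtau_left_def intro!: of_section_other)

text \<open>
  The two kinds of coefficients of \<open>{u, \<Theta>}\<close>: \<open>anchor_field u i\<close> belongs to \<open>p\<^sub>i\<close>, and is minus the
  \<open>i\<close>-th component of \<open>\<rho>(u)\<close>; \<open>rot u a b\<close> belongs to \<open>\<tau>\<^sup>a \<tau>\<^sup>b\<close>, and is skew in \<open>a\<close> and \<open>b\<close>.
\<close>

definition anchor_field :: "('m \<Rightarrow> 'v) \<Rightarrow> nat \<Rightarrow> real" where
  "anchor_field u i = (\<Sum>b<crank c. upper u b * anc b i)"

definition rot :: "('m \<Rightarrow> 'v) \<Rightarrow> nat \<Rightarrow> nat \<Rightarrow> real" where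
  "rot u a b = (\<Sum>i<mdim E. pd i (lower u a) * anc b i - pd i (lower u b) * anc a i) +
     (\<Sum>d<crank c. upper u d * skew3 d a b)"

lemma rot_skew: "rot u b a = - rot u a b"
  by (simp add: rot_def skew3_swap(1)[of _ b a] sum_negf sum_subtractf)

lemma ham_mom: "ham u c x {} {#j#} = anchor_field u j"
proof -
  have "ham u c x {} {#j#} = (\<Sum>a<crank c. \<Sum>b<crank c. g a b * (lower u a x * anc b j))"
    unfolding pbracket_def gmult_mom
    by (simp add: pd_const dtau_of_section dtau_of_section_zeros)
      (simp add: dtau_left_def anc_def)
  also have "\<dots> = (\<Sum>b<crank c. \<Sum>a<crank c. g a b * (lower u a x * anc b j))"
    by (rule sum.swap)
  also have "\<dots> = anchor_field u j"
    by (simp add: anchor_field_def upper_def sum_distrib_right mult.assoc)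
  finally show ?thesis .
qed

lemma ham_tau_tau:
  assumes "a < crank c" "b < crank c" "a \<noteq> b"
  shows "ksign {a} {b} * ham u c x {a, b} {#} = rot u a b"
proof -
  let ?k = "ksign {a} {b}"
  have k: "?k * ?k = 1" "ksign {b} {a} = - ?k" using assms(3) by (auto simp: ksign_single)
  have d: "?k * dtau_left e (\<Theta> c x) {a, b} {#} = skew3 e a b" for e
    using ksign_pair[OF assms(3), of e] assms(3) by (auto simp: dtau_left_def skew3_def)
  have "ham u c x {a, b} {#} =
      (\<Sum>i<mdim E. ?k * pd i (lower u a) * anc b i - ?k * pd i (lower u b) * anc a i) +
      (\<Sum>e<crank c. \<Sum>d<crank c. g e d * (lower u e x * dtau_left d (\<Theta> c x) {a, b} {#}))"
    unfolding pbracket_def gmult_tau_tau[OF assms(3)]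
    using assms k(2)
    by (simp add: pd_const of_section_tau dtau_of_section dtau_of_section_zeros)
      (simp add: dmom_def anc_def)
  also have "(\<Sum>e<crank c. \<Sum>d<crank c. g e d * (lower u e x * dtau_left d (\<Theta> c x) {a, b} {#})) =
      (\<Sum>d<crank c. upper u d * dtau_left d (\<Theta> c x) {a, b} {#})"
    by (subst sum.swap) (simp add: upper_def sum_distrib_right mult.assoc)
  finally have "?k * ham u c x {a, b} {#} =
      (\<Sum>i<mdim E. ?k * ?k * (pd i (lower u a) * anc b i - pd i (lower u b) * anc a i)) +
      (\<Sum>d<crank c. upper u d * (?k * dtau_left d (\<Theta> c x) {a, b} {#}))"
    by (simp add: distrib_left sum_distrib_left right_diff_distrib mult_ac)
  then show ?thesis by (simp add: k d rot_def)
qed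

lemma anchor_components:
  "pbracket E (ham u) (of_fn f) c x {} {#} = - (\<Sum>i<mdim E. anchor_field u i * pd i f)"
proof -
  have "dmom i (of_fn f c x) I J = 0" "dtau_left b (of_fn f c x) I J = 0" for i b I J
    by (auto simp: dmom_def dtau_left_def of_fn_def)
  moreover have "dmom i (ham u c x) {} {#} = anchor_field u i" for i
    by (simp add: dmom_def ham_mom)
  moreover have "(\<lambda>y. of_fn f c y {} {#}) = f" by (simp add: of_fn_def)
  ultimately show ?thesis
    unfolding pbracket_def[of E "ham u"] gmult_const by (simp add: sum_negf)
qed

lemma dorfman_components:
  assumes a: "a < crank c"
  shows "pbracket E (ham u) (of_section E v) c x {a} {#} =
    - (\<Sum>i<mdim E. anchor_field u i * pd i (lower v a)) + (\<Sum>b<crank c. upper v b * rot u a b)"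
proof -
  have r: "dtau_right b (ham u c x) {a} {#} = rot u a b" if "b < crank c" for b
    using ham_tau_tau[OF a that, of u] rot_skew[of u a a] by (auto simp: dtau_right_def insert_commute)
  have m: "dmom i (ham u c x) {} {#} = anchor_field u i" for i
    by (simp add: dmom_def ham_mom)
  have "pbracket E (ham u) (of_section E v) c x {a} {#} =
      - (\<Sum>i<mdim E. anchor_field u i * pd i (lower v a)) +
      (\<Sum>b<crank c. \<Sum>d<crank c. g b d * (rot u a b * lower v d x))"
    unfolding pbracket_def[of E "ham u"] gmult_tau
    using a by (simp add: pd_const of_section_tau dtau_of_section dtau_of_section_zeros m r sum_negf)
  also have "(\<Sum>b<crank c. \<Sum>d<crank c. g b d * (rot u a b * lower v d x)) =
      (\<Sum>b<crank c. upper v b * rot u a b)"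
    by (intro sum.cong refl) (simp add: upper_alt sum_distrib_left mult_ac)
  finally show ?thesis .
qed

text \<open>
  From here on \<open>c\<close> is the coordinate system in which \<open>to_fn\<close> and \<open>to_section\<close> read off values at \<open>x\<close>.
\<close>

context
  assumes cx: "coord_at E x = c"
begin

lemma anchor_eq: "anchor E \<Theta> u f x = - (\<Sum>i<mdim E. anchor_field u i * pd i f)"
  by (simp add: anchor_def to_fn_def cx anchor_components)

text \<open>
  The definite descriptions in \<open>to_section\<close> and \<open>courant_d\<close> are well defined by non-degeneracy of the
  form; for \<open>courant_d\<close>, uniqueness also uses that the sections span the fibre.
\<close>

lemma dorfman_eq:
  shows dorfman_fib: "dorfman E \<Theta> u v x \<in> fib E x"
    and form_dorfman: "a < crank c \<Longrightarrow> form E x (dorfman E \<Theta> u v x) (cframe c a x) =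
      - (\<Sum>i<mdim E. anchor_field u i * pd i (lower v a)) + (\<Sum>b<crank c. upper v b * rot u a b)"
proof -
  let ?P = "\<lambda>w. w \<in> fib E x \<and> (\<forall>a<crank c. form E x w (cframe c a x) =
      pbracket E (ham u) (of_section E v) c x {a} {#})"
  obtain w where w: "?P w"
    using exists_form_representative[OF coord_frame point,
        of "\<lambda>a. pbracket E (ham u) (of_section E v) c x {a} {#}"] by metis
  have "?P (THE w. ?P w)"
  proof (rule theI[of ?P, OF w])
    fix w' assume "?P w'"
    with w show "w' = w" by (intro form_eq_on_frame[OF coord_frame point]) auto
  qed
  then have *: "?P (dorfman E \<Theta> u v x)"
    by (simp add: dorfman_def to_section_def cx)
  then show "dorfman E \<Theta> u v x \<in> fib E x" by simp
  show "a < crank c \<Longrightarrow> form E x (dorfman E \<Theta> u v x) (cframe c a x) =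
      - (\<Sum>i<mdim E. anchor_field u i * pd i (lower v a)) + (\<Sum>b<crank c. upper v b * rot u a b)"
    using * dorfman_components by simp
qed

lemma courant_d_eq:
  shows courant_d_fib: "courant_d E \<Theta> f x \<in> fib E x"
    and form_courant_d: "u \<in> sections E \<Longrightarrow> form E x (u x) (courant_d E \<Theta> f x) = anchor E \<Theta> u f x"
    and form_courant_d_frame: "b < crank c \<Longrightarrow>
      form E x (courant_d E \<Theta> f x) (cframe c b x) = - (\<Sum>i<mdim E. anc b i * pd i f)"
proof -
  let ?P = "\<lambda>w. w \<in> fib E x \<and> (\<forall>u\<in>sections E. form E x (u x) w = anchor E \<Theta> u f x)"
  obtain w where w: "w \<in> fib E x" "\<forall>b<crank c. form E x w (cframe c b x) = - (\<Sum>i<mdim E. anc b i * pd i f)"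
    using exists_form_representative[OF coord_frame point,
        of "\<lambda>b. - (\<Sum>i<mdim E. anc b i * pd i f)"] by metis
  have "form E x (u x) w = anchor E \<Theta> u f x" if u: "u \<in> sections E" for u
  proof -
    have "form E x (u x) w = - (\<Sum>b<crank c. \<Sum>i<mdim E. upper u b * anc b i * pd i f)"
      using form_upper_left[of u, OF sections_fib[OF u] w(1)] w(2)
      by (simp add: sum_negf sum_distrib_left mult.assoc)
    also have "\<dots> = anchor E \<Theta> u f x"
      unfolding anchor_eq anchor_field_def by (subst sum.swap) (simp add: sum_distrib_right)
    finally show ?thesis .
  qed
  with w(1) have Pw: "?P w" by simp
  have the: "(THE w. ?P w) = w"
  proof (rule the_equality[of ?P, OF Pw])
    fix w' assume w': "?P w'"
    have "w' - w = 0"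
    proof (rule form_nondegenerate)
      show "w' - w \<in> fib E x" using w' w(1) by (intro fib_diff) auto
      fix v assume v: "v \<in> fib E x"
      obtain s where "s \<in> sections E" "s x = v" by (rule exists_section[OF v])
      then show "form E x (w' - w) v = 0"
        using w' Pw v form_commute[of "w' - w" x v] by (auto simp: form_diff_right fib_diff)
    qed
    then show "w' = w" by simp
  qed
  then have "courant_d E \<Theta> f x = w" by (simp add: courant_d_def)
  then show "courant_d E \<Theta> f x \<in> fib E x"
    "u \<in> sections E \<Longrightarrow> form E x (u x) (courant_d E \<Theta> f x) = anchor E \<Theta> u f x"
    "b < crank c \<Longrightarrow>
      form E x (courant_d E \<Theta> f x) (cframe c b x) = - (\<Sum>i<mdim E. anc b i * pd i f)"
    using Pw w(2) by auto
qed

text \<open>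
  In \<open>[u, v] + [v, u]\<close> the derivatives along \<open>\<rho>(u)\<close> and \<open>\<rho>(v)\<close> and the cubic terms cancel, which
  leaves the derivative of \<open>g\<^sup>a\<^sup>b u\<^sub>a v\<^sub>b\<close> along \<open>\<rho>(e\<^sub>a)\<close>.
\<close>

lemma dorfman_symmetric_part_at:
  assumes u: "u \<in> sections E" and v: "v \<in> sections E"
  shows "dorfman E \<Theta> u v x + dorfman E \<Theta> v u x = courant_d E \<Theta> (pairing E u v) x"
proof (rule form_eq_on_frame[OF coord_frame point])
  show "dorfman E \<Theta> u v x + dorfman E \<Theta> v u x \<in> fib E x" by (intro fib_add dorfman_fib)
  show "courant_d E \<Theta> (pairing E u v) x \<in> fib E x" by (rule courant_d_fib)
  fix a assume a: "a < crank c"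
  have skew: "(\<Sum>b<crank c. upper v b * (\<Sum>d<crank c. upper u d * skew3 d a b)) =
      - (\<Sum>b<crank c. upper u b * (\<Sum>d<crank c. upper v d * skew3 d a b))"
  proof -
    have "(\<Sum>b<crank c. upper v b * (\<Sum>d<crank c. upper u d * skew3 d a b)) =
        (\<Sum>d<crank c. \<Sum>b<crank c. upper v b * (upper u d * skew3 d a b))"
      unfolding sum_distrib_left by (rule sum.swap)
    also have "\<dots> = (\<Sum>d<crank c. \<Sum>b<crank c. - (upper u d * (upper v b * skew3 b a d)))"
    proof (intro sum.cong refl)
      fix d b
      show "upper v b * (upper u d * skew3 d a b) = - (upper u d * (upper v b * skew3 b a d))"
        using skew3_swap(2)[of b a d] by simp
    qed
    finally show ?thesis by (simp add: sum_distrib_left sum_negf)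
  qed
  have rot: "(\<Sum>b<crank c. upper v b * rot u a b) =
      (\<Sum>i<mdim E. anchor_field v i * pd i (lower u a)) -
      (\<Sum>i<mdim E. anc a i * (\<Sum>b<crank c. upper v b * pd i (lower u b))) +
      (\<Sum>b<crank c. upper v b * (\<Sum>d<crank c. upper u d * skew3 d a b))" for u v
  proof -
    have "(\<Sum>b<crank c. upper v b * rot u a b) =
        (\<Sum>b<crank c. \<Sum>i<mdim E. upper v b * (pd i (lower u a) * anc b i)) -
        (\<Sum>b<crank c. \<Sum>i<mdim E. upper v b * (pd i (lower u b) * anc a i)) +
        (\<Sum>b<crank c. upper v b * (\<Sum>d<crank c. upper u d * skew3 d a b))"
      by (simp add: rot_def distrib_left sum.distrib sum_distrib_left right_diff_distrib sum_subtractf)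
    also have "(\<Sum>b<crank c. \<Sum>i<mdim E. upper v b * (pd i (lower u a) * anc b i)) =
        (\<Sum>i<mdim E. anchor_field v i * pd i (lower u a))"
      by (subst sum.swap) (simp add: anchor_field_def sum_distrib_left mult_ac)
    also have "(\<Sum>b<crank c. \<Sum>i<mdim E. upper v b * (pd i (lower u b) * anc a i)) =
        (\<Sum>i<mdim E. anc a i * (\<Sum>b<crank c. upper v b * pd i (lower u b)))"
      by (subst sum.swap) (simp add: sum_distrib_left mult_ac)
    finally show ?thesis .
  qed
  have "form E x (dorfman E \<Theta> u v x + dorfman E \<Theta> v u x) (cframe c a x) =
      form E x (dorfman E \<Theta> u v x) (cframe c a x) + form E x (dorfman E \<Theta> v u x) (cframe c a x)"
    by (rule form_add_left[OF dorfman_fib dorfman_fib cframe_fib[OF point a]])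
  also have "\<dots> = - (\<Sum>i<mdim E. anc a i * (\<Sum>b<crank c. upper v b * pd i (lower u b)))
      - (\<Sum>i<mdim E. anc a i * (\<Sum>b<crank c. upper u b * pd i (lower v b)))"
    using a by (simp add: form_dorfman rot skew)
  also have "\<dots> = - (\<Sum>i<mdim E. anc a i * pd i (pairing E u v))"
    by (simp add: pd_pairing[OF u v] distrib_left sum.distrib)
  also have "\<dots> = form E x (courant_d E \<Theta> (pairing E u v) x) (cframe c a x)"
    by (simp add: form_courant_d_frame[OF a])
  finally show "form E x (dorfman E \<Theta> u v x + dorfman E \<Theta> v u x) (cframe c a x) =
      form E x (courant_d E \<Theta> (pairing E u v) x) (cframe c a x)" .
qed

text \<open>The terms with \<open>rot\<close> cancel because \<open>rot u\<close> is skew.\<close>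

lemma dorfman_invariant_at:
  assumes u: "u \<in> sections E" and v: "v \<in> sections E" and w: "w \<in> sections E"
  shows "form E x (dorfman E \<Theta> u v x) (w x) + form E x (v x) (dorfman E \<Theta> u w x) =
    form E x (u x) (courant_d E \<Theta> (pairing E v w) x)"
proof -
  have expand: "form E x (w x) (dorfman E \<Theta> u v x) =
      - (\<Sum>i<mdim E. anchor_field u i * (\<Sum>a<crank c. upper w a * pd i (lower v a))) +
      (\<Sum>a<crank c. \<Sum>b<crank c. upper w a * upper v b * rot u a b)"
    if "w \<in> sections E" for v w
  proof -
    have "form E x (w x) (dorfman E \<Theta> u v x) =
        (\<Sum>a<crank c. - (\<Sum>i<mdim E. upper w a * (anchor_field u i * pd i (lower v a))) +
          (\<Sum>b<crank c. upper w a * upper v b * rot u a b))"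
      using form_upper_left[of w, OF sections_fib[OF that] dorfman_fib]
      by (simp add: form_dorfman distrib_left sum_distrib_left mult.assoc right_diff_distrib)
    also have "\<dots> = - (\<Sum>a<crank c. \<Sum>i<mdim E. upper w a * (anchor_field u i * pd i (lower v a))) +
        (\<Sum>a<crank c. \<Sum>b<crank c. upper w a * upper v b * rot u a b)"
      by (simp add: sum.distrib sum_negf sum_subtractf)
    also have "(\<Sum>a<crank c. \<Sum>i<mdim E. upper w a * (anchor_field u i * pd i (lower v a))) =
        (\<Sum>i<mdim E. anchor_field u i * (\<Sum>a<crank c. upper w a * pd i (lower v a)))"
      by (subst sum.swap) (simp add: sum_distrib_left mult_ac)
    finally show ?thesis .
  qed
  have "(\<Sum>a<crank c. \<Sum>b<crank c. upper w a * upper v b * rot u a b) =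
      (\<Sum>b<crank c. \<Sum>a<crank c. upper w a * upper v b * rot u a b)"
    by (rule sum.swap)
  also have "\<dots> = - (\<Sum>b<crank c. \<Sum>a<crank c. upper v b * upper w a * rot u b a)"
    unfolding sum_negf[symmetric]
  proof (intro sum.cong refl)
    fix b a
    show "upper w a * upper v b * rot u a b = - (upper v b * upper w a * rot u b a)"
      using rot_skew[of u b a] by simp
  qed
  finally have "form E x (w x) (dorfman E \<Theta> u v x) + form E x (v x) (dorfman E \<Theta> u w x) =
      - (\<Sum>i<mdim E. anchor_field u i * pd i (pairing E v w))"
    by (simp add: expand[OF w] expand[OF v] pd_pairing[OF v w] distrib_left sum.distrib)
  then show ?thesis
    using form_courant_d[OF u] anchor_eq
      form_commute[OF dorfman_fib sections_fib[OF w], of u v] by simp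
qed

lemma courant_d_minus_at:
  assumes "smooth_fn E UNIV f"
  shows "courant_d E \<Theta> (\<lambda>y. - f y) x = - courant_d E \<Theta> f x"
proof (rule form_eq_on_frame[OF coord_frame point courant_d_fib fib_uminus[OF courant_d_fib]])
  fix b assume b: "b < crank c"
  have "pd i (\<lambda>y. - f y) = - pd i f" for i
    using pd_cmult[OF smooth_fn_subset[OF assms subset_UNIV], of i "-1"] by simp
  then show "form E x (courant_d E \<Theta> (\<lambda>y. - f y) x) (cframe c b x) =
      form E x (- courant_d E \<Theta> f x) (cframe c b x)"
    using form_minus_left[OF courant_d_fib cframe_fib[OF point b]]
    by (simp add: form_courant_d_frame[OF b] sum_negf)
qed

lemma dorfman_scale_at:
  assumes u: "u \<in> sections E" and v: "v \<in> sections E"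
  shows "dorfman E \<Theta> (\<lambda>y. k *\<^sub>R u y) (\<lambda>y. l *\<^sub>R v y) x = (k * l) *\<^sub>R dorfman E \<Theta> u v x"
proof (rule form_eq_on_frame[OF coord_frame point dorfman_fib fib_scale[OF dorfman_fib]])
  fix a assume a: "a < crank c"
  have low: "lower (\<lambda>y. k *\<^sub>R u y) a x = k * lower u a x" if "a < crank c" "u \<in> sections E" for k u a
    using that point by (simp add: lower_def form_scale_left sections_fib cframe_fib)
  have up: "upper (\<lambda>y. k *\<^sub>R u y) b = k * upper u b" if "u \<in> sections E" for k u b
    using that by (simp add: upper_def low sum_distrib_left mult_ac)
  have pd: "pd i (lower (\<lambda>y. k *\<^sub>R u y) a) = k * pd i (lower u a)"
    if "a < crank c" "u \<in> sections E" for k u a i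
  proof -
    have "pd i (\<lambda>y. k * lower u a y) = pd i (lower (\<lambda>y. k *\<^sub>R u y) a)"
      using smooth_fn_mult[OF coord_open smooth_fn_const lower_smooth[OF that(2,1)]] that
      by (intro pd_cong) (simp_all add: lower_def form_scale_left sections_fib cframe_fib)
    then show ?thesis using pd_cmult[OF lower_smooth[OF that(2,1)]] by simp
  qed
  have fi: "anchor_field (\<lambda>y. k *\<^sub>R u y) i = k * anchor_field u i" for i
    by (simp add: anchor_field_def up[OF u] sum_distrib_left mult_ac)
  have ro: "rot (\<lambda>y. k *\<^sub>R u y) a b = k * rot u a b" if "b < crank c" for b
    using that a
    by (simp add: rot_def up[OF u] pd[OF _ u] sum_distrib_left distrib_left right_diff_distrib mult_ac)
  show "form E x (dorfman E \<Theta> (\<lambda>y. k *\<^sub>R u y) (\<lambda>y. l *\<^sub>R v y) x) (cframe c a x) =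
      form E x ((k * l) *\<^sub>R dorfman E \<Theta> u v x) (cframe c a x)"
    using form_scale_left[OF dorfman_fib cframe_fib[OF point a]] a
    by (simp add: form_dorfman fi ro pd[OF a v] up[OF v] sum_distrib_left distrib_left right_diff_distrib mult_ac)
qed

end

end

section \<open>Nijenhuis tensors\<close>

context pseudo_euclidean_bundle
begin

lemma local_coordinates_at: "local_coordinates E (coord_at E x) x"
proof -
  have "coord_at E x \<in> coords E \<and> x \<in> cdom (coord_at E x)"
    unfolding coord_at_def by (rule someI_ex) (use exists_coord in blast)
  then show ?thesis by unfold_locales auto
qed

lemma fib_dorfman: "dorfman E \<Theta> u v x \<in> fib E x"
proof -
  interpret local_cubic E "coord_at E x" x \<Theta>
    using local_coordinates_at by (rule local_cubic.intro)
  show ?thesis by (rule dorfman_fib[OF refl])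
qed

lemma fib_courant_d: "courant_d E \<Theta> f x \<in> fib E x"
proof -
  interpret local_cubic E "coord_at E x" x \<Theta>
    using local_coordinates_at by (rule local_cubic.intro)
  show ?thesis by (rule courant_d_fib[OF refl])
qed

lemma dorfman_symmetric_part:
  assumes "u \<in> sections E" "v \<in> sections E"
  shows "dorfman E \<Theta> u v x + dorfman E \<Theta> v u x = courant_d E \<Theta> (pairing E u v) x"
proof -
  interpret local_cubic E "coord_at E x" x \<Theta>
    using local_coordinates_at by (rule local_cubic.intro)
  show ?thesis by (rule dorfman_symmetric_part_at[OF refl assms])
qed

lemma dorfman_invariant:
  assumes "u \<in> sections E" "v \<in> sections E" "w \<in> sections E"
  shows "form E x (dorfman E \<Theta> u v x) (w x) + form E x (v x) (dorfman E \<Theta> u w x) =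
    form E x (u x) (courant_d E \<Theta> (pairing E v w) x)"
proof -
  interpret local_cubic E "coord_at E x" x \<Theta>
    using local_coordinates_at by (rule local_cubic.intro)
  show ?thesis by (rule dorfman_invariant_at[OF refl assms])
qed

lemma courant_d_minus:
  assumes "smooth_fn E UNIV f"
  shows "courant_d E \<Theta> (\<lambda>y. - f y) x = - courant_d E \<Theta> f x"
proof -
  interpret local_cubic E "coord_at E x" x \<Theta>
    using local_coordinates_at by (rule local_cubic.intro)
  show ?thesis by (rule courant_d_minus_at[OF refl assms])
qed

lemma dorfman_scale:
  assumes "u \<in> sections E" "v \<in> sections E"
  shows "dorfman E \<Theta> (\<lambda>y. k *\<^sub>R u y) (\<lambda>y. l *\<^sub>R v y) x = (k * l) *\<^sub>R dorfman E \<Theta> u v x"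
proof -
  interpret local_cubic E "coord_at E x" x \<Theta>
    using local_coordinates_at by (rule local_cubic.intro)
  show ?thesis by (rule dorfman_scale_at[OF refl assms])
qed

lemma skew_endoD:
  assumes "skew_endo E N"
  shows "is_endo E N"
    and "u \<in> fib E x \<Longrightarrow> v \<in> fib E x \<Longrightarrow> form E x (N x u) v = - form E x u (N x v)"
proof -
  show "is_endo E N" using assms by (simp add: skew_endo_def)
  assume "u \<in> fib E x" "v \<in> fib E x"
  then have "form E x (N x u) v + form E x u (N x v) = 0" using assms by (simp add: skew_endo_def)
  then show "form E x (N x u) v = - form E x u (N x v)" by simp
qed

lemma courant_d_pairing_skew:
  assumes N: "skew_endo E N" and u: "u \<in> sections E" and v: "v \<in> sections E"
  shows "courant_d E \<Theta> (pairing E (endo_app N u) v) x = - courant_d E \<Theta> (pairing E u (endo_app N v)) x"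
proof -
  have "smooth_fn E UNIV (pairing E u (endo_app N v))"
    unfolding pairing_def[abs_def]
    by (intro smooth_fn_form open_UNIV sections_on u sections_endo skew_endoD(1)[OF N] v)
  moreover have "pairing E (endo_app N u) v = (\<lambda>y. - pairing E u (endo_app N v) y)"
    using skew_endoD(2)[OF N sections_fib[OF u] sections_fib[OF v]]
    by (simp add: pairing_def endo_app_def)
  ultimately show ?thesis by (simp add: courant_d_minus)
qed

context
  fixes \<Theta> :: "('m, 'b, 'v) gfn" and N :: "'m \<Rightarrow> 'v \<Rightarrow> 'v"
  assumes N: "nijenhuis_tensor E \<Theta> N"
begin

lemma nijenhuis_skew: "skew_endo E N"
  using N by (simp add: nijenhuis_tensor_def)

lemma nijenhuis_endo: "is_endo E N"
  by (rule skew_endoD(1)[OF nijenhuis_skew])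

lemmas nijenhuis_sections = sections_endo[OF nijenhuis_endo]

lemma nijenhuis_dorfman:
  assumes "u \<in> sections E" "v \<in> sections E"
  shows "dorfman E \<Theta> (endo_app N u) (endo_app N v) x =
    N x (dorfman E \<Theta> (endo_app N u) v x + dorfman E \<Theta> u (endo_app N v) x - N x (dorfman E \<Theta> u v x))"
proof -
  have "torsion E \<Theta> N u v x = 0"
    using N assms by (simp add: nijenhuis_tensor_def torsion_free_def)
  then show ?thesis by (simp add: torsion_def)
qed

text \<open>This is the vanishing of the symmetric part \<open>T(u, v) + T(v, u)\<close> of the torsion.\<close>

lemma nijenhuis_square_courant_d:
  assumes u: "u \<in> sections E" and v: "v \<in> sections E"
  shows "N x (N x (courant_d E \<Theta> (pairing E u v) x)) =
    courant_d E \<Theta> (pairing E u (endo_app N (endo_app N v))) x"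
proof -
  let ?B = "\<lambda>u v. dorfman E \<Theta> u v x" and ?D = "\<lambda>u v. courant_d E \<Theta> (pairing E u v) x"
  let ?u = "endo_app N u" and ?v = "endo_app N v"
  note s = u v nijenhuis_sections[OF u] nijenhuis_sections[OF v]
  note fib = fib_dorfman fib_courant_d fib_add fib_diff fib_uminus endoD(1)[OF nijenhuis_endo]
  have "?D ?u ?v = ?B ?u ?v + ?B ?v ?u"
    by (rule dorfman_symmetric_part[symmetric]) (use s in auto)
  also have "\<dots> = N x (?B ?u v + ?B u ?v - N x (?B u v)) + N x (?B ?v u + ?B v ?u - N x (?B v u))"
    using s by (simp add: nijenhuis_dorfman)
  also have "\<dots> = N x ((?B ?u v + ?B u ?v - N x (?B u v)) + (?B ?v u + ?B v ?u - N x (?B v u)))"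
    by (rule endoD(2)[OF nijenhuis_endo, symmetric]) (intro fib)+
  also have "(?B ?u v + ?B u ?v - N x (?B u v)) + (?B ?v u + ?B v ?u - N x (?B v u)) =
      (?B ?u v + ?B v ?u) + (?B u ?v + ?B ?v u) - (N x (?B u v) + N x (?B v u))"
    by simp
  also have "N x (?B u v) + N x (?B v u) = N x (?B u v + ?B v u)"
    by (rule endoD(2)[OF nijenhuis_endo, symmetric]) (intro fib)+
  also have "(?B ?u v + ?B v ?u) + (?B u ?v + ?B ?v u) - N x (?B u v + ?B v u) =
      ?D ?u v + ?D u ?v - N x (?D u v)"
    using s by (simp add: dorfman_symmetric_part)
  also have "?D ?u v = - ?D u ?v"
    by (rule courant_d_pairing_skew[OF nijenhuis_skew u v])
  also have "N x (- ?D u ?v + ?D u ?v - N x (?D u v)) = - N x (N x (?D u v))"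
    by (simp add: endo_minus[OF nijenhuis_endo] fib)
  finally have "?D ?u ?v = - N x (N x (?D u v))" .
  then show ?thesis
    using courant_d_pairing_skew[OF nijenhuis_skew u s(4), of \<Theta> x] by simp
qed

text \<open>
  This is the vanishing of \<open>\<langle>T(u, v), w\<rangle> + \<langle>v, T(u, w)\<rangle>\<close>, in which four instances of invariance
  cancel everything except \<open>\<langle>v, N\<^sup>2 [u, w] - [u, N\<^sup>2 w]\<rangle>\<close>.
\<close>

lemma nijenhuis_square_dorfman:
  assumes u: "u \<in> sections E" and w: "w \<in> sections E"
  shows "N x (N x (dorfman E \<Theta> u w x)) = dorfman E \<Theta> u (endo_app N (endo_app N w)) x"
proof -
  let ?B = "\<lambda>u v. dorfman E \<Theta> u v x" and ?D = "\<lambda>u v. courant_d E \<Theta> (pairing E u v) x"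
  let ?N = "endo_app N" and ?F = "form E x"
  note sec = nijenhuis_sections
  note fib = fib_dorfman endoD(1)[OF nijenhuis_endo] sections_fib
  note skew = skew_endoD(2)[OF nijenhuis_skew]
  have "?F (N x (N x (?B u w)) - ?B u (?N (?N w))) z = 0" if z: "z \<in> fib E x" for z
  proof -
    obtain v where v: "v \<in> sections E" "v x = z" by (rule exists_section[OF z])
    have torsion_v: "?F (?B (?N u) (?N v)) (w x) =
        - ?F (?B (?N u) v) (?N w x) - ?F (?B u (?N v)) (?N w x) - ?F (?B u v) (?N (?N w) x)"
    proof -
      have "?F (N x y) (w x) = - ?F y (?N w x)" "?F (N x y) (?N w x) = - ?F y (?N (?N w) x)"
        if "y \<in> fib E x" for y
        using skew[OF that sections_fib[OF w]] skew[OF that sections_fib[OF sec[OF w]]]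
        by (simp_all add: endo_app_def)
      then show ?thesis
        using u v(1) w sec[OF w]
        by (simp add: nijenhuis_dorfman fib fib_add fib_diff form_add_left form_diff_left)
    qed
    have torsion_w: "?F (v x) (?B (?N u) (?N w)) =
        - ?F (?N v x) (?B (?N u) w) - ?F (?N v x) (?B u (?N w)) - ?F (v x) (N x (N x (?B u w)))"
    proof -
      have "?F (v x) (N x y) = - ?F (?N v x) y" if "y \<in> fib E x" for y
        using skew[OF sections_fib[OF v(1)] that] by (simp add: endo_app_def)
      then show ?thesis
        using u v(1) w sec[OF v(1)]
        by (simp add: nijenhuis_dorfman fib fib_add fib_diff form_add_right form_diff_right)
    qed
    have "?F (?B (?N u) (?N v)) (w x) + ?F (?N v x) (?B (?N u) w) = ?F (?N u x) (?D (?N v) w)"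
      "?F (?B (?N u) v) (?N w x) + ?F (v x) (?B (?N u) (?N w)) = ?F (?N u x) (?D v (?N w))"
      "?F (?B u (?N v)) (?N w x) + ?F (?N v x) (?B u (?N w)) = ?F (u x) (?D (?N v) (?N w))"
      "?F (?B u v) (?N (?N w) x) + ?F (v x) (?B u (?N (?N w))) = ?F (u x) (?D v (?N (?N w)))"
      by (rule dorfman_invariant[OF sec[OF u] sec[OF v(1)] w] dorfman_invariant[OF sec[OF u] v(1) sec[OF w]]
          dorfman_invariant[OF u sec[OF v(1)] sec[OF w]] dorfman_invariant[OF u v(1) sec[OF sec[OF w]]])+
    moreover have "?F (?N u x) (?D (?N v) w) = - ?F (?N u x) (?D v (?N w))"
      by (simp add: courant_d_pairing_skew[OF nijenhuis_skew v(1) w] form_minus_right fib_courant_d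
          sections_fib sec u)
    moreover have "?F (u x) (?D (?N v) (?N w)) = - ?F (u x) (?D v (?N (?N w)))"
      by (simp add: courant_d_pairing_skew[OF nijenhuis_skew v(1) sec[OF w]] form_minus_right
          fib_courant_d sections_fib u)
    ultimately have "?F (v x) (N x (N x (?B u w))) = ?F (v x) (?B u (?N (?N w)))"
      using torsion_v torsion_w by linarith
    then show ?thesis
      using v z by (simp add: form_diff_left fib form_commute[OF _ z])
  qed
  then have "N x (N x (?B u w)) - ?B u (?N (?N w)) = 0"
    by (intro form_nondegenerate) (auto intro: fib fib_diff)
  then show ?thesis by simp
qed

lemma nijenhuis_square_dorfman_left:
  assumes u: "u \<in> sections E" and v: "v \<in> sections E"
  shows "N x (N x (dorfman E \<Theta> u v x)) = dorfman E \<Theta> (endo_app N (endo_app N u)) v x"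
proof -
  let ?B = "\<lambda>u v. dorfman E \<Theta> u v x" and ?D = "\<lambda>u v. courant_d E \<Theta> (pairing E u v) x"
  let ?u = "endo_app N (endo_app N u)"
  have s: "?u \<in> sections E" by (intro nijenhuis_sections u)
  have "pairing E ?u v = pairing E v ?u"
    using form_commute[OF sections_fib[OF s] sections_fib[OF v]] by (simp add: pairing_def)
  then have "?B ?u v + ?B v ?u = ?D v ?u"
    using dorfman_symmetric_part[OF s v, of \<Theta> x] by simp
  also have "\<dots> = N x (N x (?B v u + ?B u v))"
    using nijenhuis_square_courant_d[OF v u, of x] dorfman_symmetric_part[OF v u, of \<Theta> x] by simp
  also have "\<dots> = N x (N x (?B v u)) + N x (N x (?B u v))"
    by (simp add: endoD(1,2)[OF nijenhuis_endo] fib_dorfman)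
  also have "N x (N x (?B v u)) = ?B v ?u" by (rule nijenhuis_square_dorfman[OF v u])
  finally show ?thesis by simp
qed

text \<open>
  On an irreducible Courant algebroid \<open>N\<^sup>2 = k Id\<close>, and unless \<open>k = 0\<close>, dividing \<open>N\<close> by \<open>sqrt \<bar>k\<bar>\<close>
  makes the square equal to \<open>sgn k Id\<close>.
\<close>

lemma nijenhuis_proportional_cps:
  assumes irr: "irreducible_courant E \<Theta>"
  shows "\<exists>J. generalized_cps E \<Theta> J \<and> proportional E N J"
proof -
  let ?\<phi> = "\<lambda>x v. N x (N x v)"
  have app: "endo_app ?\<phi> v = endo_app N (endo_app N v)" for v by (simp add: endo_app_def)
  note skew = skew_endoD(2)[OF nijenhuis_skew]
  have "symmetric_endo E ?\<phi>"
    using is_endo_compose[OF nijenhuis_endo nijenhuis_endo]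
    by (simp add: symmetric_endo_def skew endoD(1)[OF nijenhuis_endo])
  moreover have "dorfman E \<Theta> u (endo_app ?\<phi> v) = endo_app ?\<phi> (dorfman E \<Theta> u v)"
    "dorfman E \<Theta> (endo_app ?\<phi> u) v = endo_app ?\<phi> (dorfman E \<Theta> u v)"
    if "u \<in> sections E" "v \<in> sections E" for u v
    using nijenhuis_square_dorfman[OF that] nijenhuis_square_dorfman_left[OF that]
    by (simp_all add: app) (auto simp: endo_app_def)
  ultimately have "proportional E ?\<phi> (\<lambda>x v. v)"
    using irr unfolding irreducible_courant_def by blast
  then obtain k where k: "\<And>x u. u \<in> fib E x \<Longrightarrow> N x (N x u) = k *\<^sub>R u"
    by (auto simp: proportional_def)
  show ?thesis
  proof (cases "k = 0")
    case True
    have "generalized_cps E \<Theta> N"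
      using N k True
      by (simp add: generalized_cps_def generalized_almost_cps_def nijenhuis_tensor_def)
    moreover have "proportional E N N"
      unfolding proportional_def by (intro exI[of _ 1]) simp
    ultimately show ?thesis by blast
  next
    case False
    define s where "s = 1 / sqrt \<bar>k\<bar>"
    have s: "s * s * k = sgn k" "s \<noteq> 0" "1 / s = sqrt \<bar>k\<bar>"
      using False by (auto simp: s_def sgn_if)
    let ?J = "\<lambda>x v. s *\<^sub>R N x v"
    have endo: "is_endo E ?J" by (rule is_endo_scale[OF nijenhuis_endo])
    have "skew_endo E ?J"
      using endo skew
      by (simp add: skew_endo_def form_scale_left form_scale_right endoD(1)[OF nijenhuis_endo])
    moreover have "?J x (?J x u) = sgn k *\<^sub>R u" if "u \<in> fib E x" for x u
      using that s(1) by (simp add: endoD(1,3)[OF nijenhuis_endo] k)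
    then have "(\<forall>x. \<forall>u\<in>fib E x. ?J x (?J x u) = - u) \<or> (\<forall>x. \<forall>u\<in>fib E x. ?J x (?J x u) = u)"
      using False by (cases "k > 0") (simp_all add: sgn_if)
    moreover have "torsion_free E \<Theta> ?J"
      unfolding torsion_free_def
    proof (intro ballI allI)
      fix u v x assume u: "u \<in> sections E" and v: "v \<in> sections E"
      have J: "endo_app ?J u = (\<lambda>y. s *\<^sub>R endo_app N u y)" for u by (simp add: endo_app_def)
      let ?B = "\<lambda>u v. dorfman E \<Theta> u v x"
      let ?z = "?B (endo_app N u) v + ?B u (endo_app N v) - N x (?B u v)"
      have z: "?z \<in> fib E x"
        by (intro fib_add fib_diff fib_dorfman endoD(1)[OF nijenhuis_endo])
      have "?B (endo_app ?J u) (endo_app ?J v) = (s * s) *\<^sub>R ?B (endo_app N u) (endo_app N v)"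
        unfolding J by (rule dorfman_scale) (intro nijenhuis_sections u v)+
      moreover have "?B (endo_app ?J u) v = s *\<^sub>R ?B (endo_app N u) v"
        unfolding J using dorfman_scale[OF nijenhuis_sections[OF u] v, of \<Theta> s 1 x] by simp
      moreover have "?B u (endo_app ?J v) = s *\<^sub>R ?B u (endo_app N v)"
        unfolding J using dorfman_scale[OF u nijenhuis_sections[OF v], of \<Theta> 1 s x] by simp
      moreover have "?J x (s *\<^sub>R ?z) = (s * s) *\<^sub>R N x ?z"
        using z by (simp add: endoD(3)[OF nijenhuis_endo])
      ultimately show "torsion E \<Theta> ?J u v x = 0"
        using nijenhuis_dorfman[OF u v, of x]
        by (simp add: torsion_def scaleR_add_right scaleR_diff_right)
    qed
    ultimately have "generalized_cps E \<Theta> ?J"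
      by (auto simp: generalized_cps_def generalized_almost_cps_def)
    moreover have "proportional E N ?J"
      unfolding proportional_def by (intro exI[of _ "1 / s"]) (simp add: s(2))
    ultimately show ?thesis by blast
  qed
qed

end

end

theorem theorem3p7:
  fixes E :: "('m::{t2_space,second_countable_topology}, 'b::real_inner, 'v::real_vector) vbundle"
    and \<Theta> :: "('m, 'b, 'v) gfn"
  assumes "is_pseudo_euclidean_bundle E"
    and "is_courant_structure E \<Theta>"
  shows "(\<forall>N. nijenhuis_tensor E \<Theta> N \<longrightarrow>
            (\<forall>u\<in>sections E. \<forall>v\<in>sections E.
               endo_app N (endo_app N (dorfman E \<Theta> u v)) =
                 dorfman E \<Theta> u (endo_app N (endo_app N v)) \<and>
               endo_app N (endo_app N (courant_d E \<Theta> (pairing E u v))) =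
                 courant_d E \<Theta> (pairing E u (endo_app N (endo_app N v))))) \<and>
         (irreducible_courant E \<Theta> \<longrightarrow>
            (\<forall>N. nijenhuis_tensor E \<Theta> N \<longrightarrow>
               (\<exists>J. generalized_cps E \<Theta> J \<and> proportional E N J)))"
proof -
  interpret pseudo_euclidean_bundle E
    using assms(1) by unfold_locales
  have "endo_app N (endo_app N (dorfman E \<Theta> u v)) = dorfman E \<Theta> u (endo_app N (endo_app N v))"
    "endo_app N (endo_app N (courant_d E \<Theta> (pairing E u v))) =
      courant_d E \<Theta> (pairing E u (endo_app N (endo_app N v)))"
    if "nijenhuis_tensor E \<Theta> N" "u \<in> sections E" "v \<in> sections E" for N u v
    using nijenhuis_square_dorfman[OF that] nijenhuis_square_courant_d[OF that]
    by (auto simp: endo_app_def)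
  then show ?thesis using nijenhuis_proportional_cps by blast
qed

end
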